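(* Let $\mathcal{N}$ be a $C^2$ submanifold without boundary of $\mathbb{P}(\mathbb{R}^j)$. Let $d_{\mathbb{P}}=\sin d_R$, where $d_R$ is the Riemannian distance on $\mathbb{P}(\mathbb{R}^j)$, and let $\alpha(x)=d_{\mathbb{P}}(x,\mathcal{N})^{-2}$. Let $\mathcal{U}$ be the largest open subset of $\mathbb{P}(\mathbb{R}^j)$ such that for every $x\in\mathcal{U}$ there is a unique closest point from $\mathcal{N}$ to $x$ for the distance $d_{\mathbb{P}}$. Then the map $\alpha:\mathcal{U}\setminus\mathcal{N}\to\mathbb{R}$ is self-convex.
   Context: $\mathbb{P}(\mathbb{R}^j)$ is the real projective space of lines through the origin in $\mathbb{R}^j$, with its usual Riemannian metric (the one making the canonical projection from the unit sphere a Riemannian submersion); the associated distance $d_R$ between two lines is the angle they make (in $[0,\pi/2]$). $d_{\mathbb{P}}=\sin d_R$ is also a distance, and $d_{\mathbb{P}}(x,\mathcal{N})=\inf_{y\in\mathcal{N}}d_{\mathbb{P}}(x,y)$. Self-convexity: let $(\mathcal{M},\langle\cdot,\cdot\rangle)$ be a Riemannian manifold and $\alpha:\mathcal{M}\to\mathbb{R}$ a $C^2$ function with positive values. Let $\mathcal{M}_\kappa$ be $\mathcal{M}$ with the new metric $\langle\cdot,\cdot\rangle_{\kappa,x}=\alpha(x)\langle\cdot,\cdot\rangle_x$. The function $\alpha$ is self-convex when $t\mapsto\log\alpha(\gamma(t))$ is convex for every geodesic $\gamma$ in $\mathcal{M}_\kappa$. *)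

theory Defs
  imports "HOL-Analysis.Analysis"
begin

section \<open>Calculus in Euclidean space\<close>

definition C2_on :: "('a::real_normed_vector \<Rightarrow> 'b::real_normed_vector) \<Rightarrow> 'a set \<Rightarrow> bool" where
  "C2_on f S \<longleftrightarrow>
     (\<exists>(f' :: 'a \<Rightarrow> 'a \<Rightarrow>\<^sub>L 'b) (f'' :: 'a \<Rightarrow> 'a \<Rightarrow>\<^sub>L ('a \<Rightarrow>\<^sub>L 'b)).
        (\<forall>x\<in>S. (f has_derivative blinfun_apply (f' x)) (at x)) \<and>
        (\<forall>x\<in>S. (f' has_derivative blinfun_apply (f'' x)) (at x)) \<and>
        continuous_on S f'')"

definition partial_deriv :: "'n \<Rightarrow> (real ^ 'n \<Rightarrow> 'b::real_normed_vector) \<Rightarrow> real ^ 'n::finite \<Rightarrow> 'b" where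
  "partial_deriv k F y = vector_derivative (\<lambda>s. F (y + s *\<^sub>R axis k 1)) (at 0)"

text \<open>Embedded, of pure dimension \<open>d\<close>, without boundary; not assumed to be closed or connected.\<close>

definition C2_submanifold_euclidean :: "nat \<Rightarrow> 'a::euclidean_space set \<Rightarrow> bool" where
  "C2_submanifold_euclidean d S \<longleftrightarrow>
     (\<forall>p\<in>S. \<exists>V W (h :: 'a \<Rightarrow> 'a) h' T.
        open V \<and> p \<in> V \<and> open W \<and> homeomorphism V W h h' \<and> C2_on h V \<and> C2_on h' W \<and>
        subspace T \<and> dim T = d \<and> h ` (V \<inter> S) = W \<inter> T)"


section \<open>Real projective space\<close>

typedef ('n::finite) proj = "{L :: (real ^ 'n) set. subspace L \<and> dim L = 1}"
  morphisms points_of Abs_proj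
proof -
  have "dim (span {axis undefined 1 :: real ^ 'n}) = 1"
    by (simp add: dim_span dim_singleton)
  then show ?thesis
    by (intro exI[of _ "span {axis undefined 1}"]) simp
qed

definition Line :: "real ^ 'n::finite \<Rightarrow> 'n proj" where
  "Line x = Abs_proj (span {x})"

lemma points_of_Line: "x \<noteq> 0 \<Longrightarrow> points_of (Line x) = span {x}"
  unfolding Line_def by (subst Abs_proj_inverse) (auto simp: dim_span dim_singleton)

text \<open>The topology is the quotient topology for \<^term>\<open>Line\<close> on the nonzero vectors.\<close>

instantiation proj :: (finite) topological_space
begin

definition open_proj :: "'a proj set \<Rightarrow> bool" where
  "open_proj W \<longleftrightarrow> open {x. x \<noteq> 0 \<and> Line x \<in> W}"

instance
proof
  show "open (UNIV :: 'a proj set)"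
  proof -
    have "{x :: real ^ 'a. x \<noteq> 0 \<and> Line x \<in> UNIV} = - {0}" by auto
    then show ?thesis by (simp add: open_proj_def open_Compl)
  qed
next
  fix S T :: "'a proj set" assume "open S" "open T"
  moreover have "{x. x \<noteq> 0 \<and> Line x \<in> S \<inter> T} =
      {x. x \<noteq> 0 \<and> Line x \<in> S} \<inter> {x. x \<noteq> 0 \<and> Line x \<in> T}" by auto
  ultimately show "open (S \<inter> T)" by (simp add: open_proj_def open_Int)
next
  fix K :: "'a proj set set" assume "\<forall>S\<in>K. open S"
  moreover have "{x. x \<noteq> 0 \<and> Line x \<in> \<Union> K} = (\<Union>S\<in>K. {x. x \<noteq> 0 \<and> Line x \<in> S})" by auto
  ultimately show "open (\<Union> K)" by (auto simp: open_proj_def intro!: open_UN)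
qed

end

text \<open>The two unit vectors on each line give the two angles \<open>\<theta>\<close> and \<open>\<pi> - \<theta>\<close>; the infimum
  selects the one in \<open>[0, \<pi>/2]\<close>.\<close>

definition dR :: "'n::finite proj \<Rightarrow> 'n proj \<Rightarrow> real" where
  "dR L M = Inf {arccos (x \<bullet> y) | x y.
     x \<in> points_of L \<and> y \<in> points_of M \<and> norm x = 1 \<and> norm y = 1}"

definition dP :: "'n::finite proj \<Rightarrow> 'n proj \<Rightarrow> real" where
  "dP L M = sin (dR L M)"

definition dP_set :: "'n::finite proj \<Rightarrow> 'n proj set \<Rightarrow> real" where
  "dP_set L N = (INF M\<in>N. dP L M)"

definition closest_point_dP :: "'n::finite proj set \<Rightarrow> 'n proj \<Rightarrow> 'n proj \<Rightarrow> bool" where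
  "closest_point_dP N L M \<longleftrightarrow> M \<in> N \<and> (\<forall>M'\<in>N. dP L M \<le> dP L M')"

definition unique_closest_domain :: "'n::finite proj set \<Rightarrow> 'n proj set" where
  "unique_closest_domain N = \<Union> {V. open V \<and> (\<forall>L\<in>V. \<exists>!M. closest_point_dP N L M)}"


section \<open>Affine charts and the differentiable structure\<close>

text \<open>The \<open>i\<close>-th affine chart is defined on the lines not contained in \<open>{y. y $ i = 0}\<close>.
  A line is represented by its point in the hyperplane \<open>{y. y $ i = 1}\<close>, the coordinates being
  the \<open>y $ k\<close> for \<open>k \<noteq> i\<close>. In particular \<open>\<partial>/\<partial>y\<^sub>k\<close> with \<open>k \<noteq> i\<close> only evaluates its argument
  on that hyperplane.\<close>

definition chart_domain :: "'n::finite \<Rightarrow> 'n proj set" where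
  "chart_domain i = {L. \<exists>y\<in>points_of L. y $ i = 1}"

definition coords :: "'n::finite \<Rightarrow> 'n proj \<Rightarrow> real ^ 'n" where
  "coords i L = (THE y. y \<in> points_of L \<and> y $ i = 1)"

definition C2_submanifold :: "nat \<Rightarrow> 'n::finite proj set \<Rightarrow> bool" where
  "C2_submanifold d N \<longleftrightarrow>
     (\<forall>i. C2_submanifold_euclidean d (coords i ` (N \<inter> chart_domain i)))"

text \<open>Since \<^term>\<open>Line\<close> is a smooth submersion from the nonzero vectors onto projective space, a
  function on an open set is \<open>C\<^sup>2\<close> iff its pullback to the nonzero vectors is.\<close>

definition C2_on_proj :: "('n::finite proj \<Rightarrow> real) \<Rightarrow> 'n proj set \<Rightarrow> bool" where
  "C2_on_proj f S \<longleftrightarrow> C2_on (\<lambda>y. f (Line y)) {y. y \<noteq> 0 \<and> Line y \<in> S}"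


section \<open>Riemannian metric, geodesics and self-convexity\<close>

text \<open>The projection of the unit sphere onto projective space is a Riemannian submersion with
  discrete fibres, hence a local isometry, and \<open>y \<mapsto> y / \<parallel>y\<parallel>\<close> is a section of it over each
  affine chart. So the metric coefficients in the chart are the inner products of the partial
  derivatives of this section.\<close>

definition proj_metric :: "'n \<Rightarrow> 'n \<Rightarrow> real ^ 'n::finite \<Rightarrow> real" where
  "proj_metric k l y = partial_deriv k (\<lambda>z. z /\<^sub>R norm z) y \<bullet> partial_deriv l (\<lambda>z. z /\<^sub>R norm z) y"

definition kappa_metric :: "('n::finite proj \<Rightarrow> real) \<Rightarrow> 'n \<Rightarrow> 'n \<Rightarrow> real ^ 'n \<Rightarrow> real" where
  "kappa_metric \<alpha> k l y = \<alpha> (Line y) * proj_metric k l y"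

text \<open>Christoffel symbols of the first kind \<open>[kl, m]\<close> of the metric with coefficients \<open>g\<close>.\<close>

definition christoffel1 ::
  "('n \<Rightarrow> 'n \<Rightarrow> real ^ 'n::finite \<Rightarrow> real) \<Rightarrow> 'n \<Rightarrow> 'n \<Rightarrow> 'n \<Rightarrow> real ^ 'n \<Rightarrow> real" where
  "christoffel1 g k l m y =
     (partial_deriv k (g l m) y + partial_deriv l (g k m) y - partial_deriv m (g k l) y) / 2"

text \<open>The geodesic equation with the upper index lowered by \<open>g\<close>, for position \<open>y\<close>, velocity \<open>v\<close>
  and acceleration \<open>a\<close>, the coordinates being indexed by \<open>K\<close>.\<close>

definition geodesic_equation ::
  "('n \<Rightarrow> 'n \<Rightarrow> real ^ 'n::finite \<Rightarrow> real) \<Rightarrow> 'n set \<Rightarrow> real ^ 'n \<Rightarrow> real ^ 'n \<Rightarrow> real ^ 'n \<Rightarrow> bool" where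
  "geodesic_equation g K y v a \<longleftrightarrow>
     (\<forall>m\<in>K. (\<Sum>l\<in>K. g m l y * a $ l) +
            (\<Sum>k\<in>K. \<Sum>l\<in>K. christoffel1 g k l m y * v $ k * v $ l) = 0)"

text \<open>The interval \<open>I\<close> may be open, closed or half-open; derivatives are one-sided at end points
  belonging to \<open>I\<close>.\<close>

definition kappa_geodesic ::
  "'n::finite proj set \<Rightarrow> ('n proj \<Rightarrow> real) \<Rightarrow> real set \<Rightarrow> (real \<Rightarrow> 'n proj) \<Rightarrow> bool" where
  "kappa_geodesic S \<alpha> I \<gamma> \<longleftrightarrow>
     is_interval I \<and> continuous_on I \<gamma> \<and> \<gamma> ` I \<subseteq> S \<and>
     (\<forall>i. \<exists>v a :: real \<Rightarrow> real ^ 'n. \<forall>t\<in>I. \<gamma> t \<in> chart_domain i \<longrightarrow>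
        ((\<lambda>s. coords i (\<gamma> s)) has_vector_derivative v t) (at t within I) \<and>
        (v has_vector_derivative a t) (at t within I) \<and>
        geodesic_equation (kappa_metric \<alpha>) (- {i}) (coords i (\<gamma> t)) (v t) (a t))"

definition self_convex :: "'n::finite proj set \<Rightarrow> ('n proj \<Rightarrow> real) \<Rightarrow> bool" where
  "self_convex S \<alpha> \<longleftrightarrow>
     open S \<and> C2_on_proj \<alpha> S \<and> (\<forall>x\<in>S. \<alpha> x > 0) \<and>
     (\<forall>I \<gamma>. kappa_geodesic S \<alpha> I \<gamma> \<longrightarrow> convex_on I (\<lambda>t. ln (\<alpha> (\<gamma> t))))"


section \<open>Consistency checks\<close>

lemma Line_surj: obtains x where "norm x = 1" "L = Line x"
proof -
  have L: "subspace (points_of L)" "dim (points_of L) = 1"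
    using points_of[of L] by auto
  then obtain z where z: "z \<in> points_of L" "z \<noteq> 0"
    by (metis dim_eq_0 insertCI subsetI zero_neq_one)
  define x where "x = z /\<^sub>R norm z"
  have x: "norm x = 1" "x \<noteq> 0" "x \<in> points_of L"
    using z L by (auto simp: x_def subspace_scale)
  have "span {x} = points_of L"
    using x L by (intro subspace_dim_equal) (auto simp: span_minimal dim_span dim_singleton)
  then have "L = Line x"
    by (metis Line_def points_of_inverse)
  then show thesis using that x by blast
qed

lemma dR_Line:
  assumes "norm x = 1" "norm y = 1"
  shows "dR (Line x) (Line y) = arccos \<bar>x \<bullet> y\<bar>"
proof -
  have unit: "{z \<in> points_of (Line w). norm z = 1} = {w, -w}" if "norm w = 1" for w :: "real ^ 'a"
  proof -
    have "w \<noteq> 0" using that by auto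
    then show ?thesis
      using that by (auto simp: points_of_Line span_singleton abs_if split: if_splits)
        (metis minus_minus rangeI scaleR_minus1_left scaleR_one)+
  qed
  have "{arccos (u \<bullet> w) | u w. u \<in> points_of (Line x) \<and> w \<in> points_of (Line y) \<and>
           norm u = 1 \<and> norm w = 1} =
        (\<lambda>(u, w). arccos (u \<bullet> w)) `
          ({z \<in> points_of (Line x). norm z = 1} \<times> {z \<in> points_of (Line y). norm z = 1})"
    by auto
  also have "\<dots> = {arccos (x \<bullet> y), arccos (- (x \<bullet> y))}"
    unfolding unit[OF assms(1)] unit[OF assms(2)] by auto
  finally have "dR (Line x) (Line y) = min (arccos (x \<bullet> y)) (arccos (- (x \<bullet> y)))"
    unfolding dR_def by (simp add: cInf_eq_Min)
  moreover have "\<bar>x \<bullet> y\<bar> \<le> 1"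
    using Cauchy_Schwarz_ineq2[of x y] assms by simp
  ultimately show ?thesis
    by (cases "x \<bullet> y \<ge> 0") (auto simp: min_def arccos_le_mono)
qed

lemma coords_Line:
  assumes "y $ i \<noteq> 0"
  shows "Line y \<in> chart_domain i" "coords i (Line y) = y /\<^sub>R (y $ i)"
proof -
  have "y \<noteq> 0" using assms by auto
  then have P: "points_of (Line y) = range (\<lambda>c. c *\<^sub>R y)"
    by (simp add: points_of_Line span_singleton)
  have m: "y /\<^sub>R (y $ i) \<in> points_of (Line y) \<and> (y /\<^sub>R (y $ i)) $ i = 1"
    using assms P by auto
  then show "Line y \<in> chart_domain i"
    unfolding chart_domain_def by blast
  show "coords i (Line y) = y /\<^sub>R (y $ i)"
    unfolding coords_def
  proof (rule the_equality)
    show "y /\<^sub>R (y $ i) \<in> points_of (Line y) \<and> (y /\<^sub>R (y $ i)) $ i = 1" by (rule m)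
  next
    fix z assume z: "z \<in> points_of (Line y) \<and> z $ i = 1"
    then obtain c where c: "z = c *\<^sub>R y" using P by blast
    then have "c = inverse (y $ i)" using z assms by (simp add: field_simps)
    then show "z = y /\<^sub>R (y $ i)" using c by simp
  qed
qed

lemma unique_closest_domain_largest:
  "open (unique_closest_domain N)"
  "L \<in> unique_closest_domain N \<Longrightarrow> \<exists>!M. closest_point_dP N L M"
  "open V \<Longrightarrow> (\<And>L. L \<in> V \<Longrightarrow> \<exists>!M. closest_point_dP N L M) \<Longrightarrow> V \<subseteq> unique_closest_domain N"
proof -
  show "open (unique_closest_domain N)"
    unfolding unique_closest_domain_def by (rule open_Union) simp
  show "\<exists>!M. closest_point_dP N L M" if "L \<in> unique_closest_domain N"
    using that unfolding unique_closest_domain_def by fast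
  show "V \<subseteq> unique_closest_domain N"
    if "open V" and "\<And>L. L \<in> V \<Longrightarrow> \<exists>!M. closest_point_dP N L M"
    unfolding unique_closest_domain_def by (rule Union_upper) (simp add: that)
qed

lemma partial_deriv_normalize:
  fixes y :: "real ^ 'n::finite"
  assumes "y \<noteq> 0"
  shows "partial_deriv k (\<lambda>z. z /\<^sub>R norm z) y =
    axis k 1 /\<^sub>R norm y - (y $ k / norm y ^ 3) *\<^sub>R y"
proof -
  have line: "((\<lambda>s. y + s *\<^sub>R axis k 1) has_derivative (\<lambda>h. h *\<^sub>R axis k 1)) (at 0)"
    by (auto intro!: derivative_eq_intros)
  have "(norm has_derivative (\<lambda>h. sgn y \<bullet> h)) (at (y + 0 *\<^sub>R axis k 1))"
    using has_derivative_norm[OF assms] by (simp add: inner_commute)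
  from diff_chain_at[OF line this]
  have "((\<lambda>s. norm (y + s *\<^sub>R axis k 1)) has_derivative (\<lambda>h. sgn y \<bullet> (h *\<^sub>R axis k 1))) (at 0)"
    by (simp add: o_def)
  moreover have "(\<lambda>h. sgn y \<bullet> (h *\<^sub>R axis k 1)) = (*) (y $ k / norm y)"
    by (auto simp: sgn_div_norm inner_axis divide_inverse)
  ultimately
  have "((\<lambda>s. norm (y + s *\<^sub>R axis k 1)) has_real_derivative y $ k / norm y) (at 0)"
    by (simp add: has_field_derivative_def)
  then have "((\<lambda>s. inverse (norm (y + s *\<^sub>R axis k 1))) has_real_derivative
      - (y $ k / norm y ^ 3)) (at 0)"
    using assms by (auto intro!: derivative_eq_intros simp: power3_eq_cube power2_eq_square field_simps)
  moreover have "((\<lambda>s. y + s *\<^sub>R axis k 1) has_vector_derivative axis k 1) (at 0)"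
    by (auto intro!: derivative_eq_intros)
  ultimately have "((\<lambda>s. (y + s *\<^sub>R axis k 1) /\<^sub>R norm (y + s *\<^sub>R axis k 1)) has_vector_derivative
      axis k 1 /\<^sub>R norm y - (y $ k / norm y ^ 3) *\<^sub>R y) (at 0)"
    by (auto dest!: has_vector_derivative_scaleR)
  then show ?thesis
    unfolding partial_deriv_def by (rule vector_derivative_at)
qed

lemma proj_metric_eq:
  fixes y :: "real ^ 'n::finite"
  assumes "y \<noteq> 0"
  shows "proj_metric k l y = ((if k = l then (norm y)\<^sup>2 else 0) - y $ k * y $ l) / norm y ^ 4"
proof -
  define r where "r = norm y"
  have r: "r > 0" "y \<bullet> y = r ^ 2"
    using assms by (auto simp: r_def power2_norm_eq_inner)
  have e: "axis k 1 \<bullet> (axis l 1 :: real ^ 'n) = (if k = l then 1 else 0)"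
    by (simp add: inner_axis_axis)
  have "proj_metric k l y =
      (if k = l then 1 else 0) / r ^ 2 - 2 * (y $ k * y $ l) / r ^ 4 + y $ k * y $ l * r ^ 2 / r ^ 6"
    unfolding proj_metric_def partial_deriv_normalize[OF assms] r_def[symmetric]
    by (simp add: algebra_simps inner_axis inner_axis' r(2) divide_inverse eval_nat_numeral)
      (simp add: axis_def)
  also have "\<dots> = ((if k = l then r ^ 2 else 0) - y $ k * y $ l) / r ^ 4"
    using r(1) by (simp add: field_simps)
  finally show ?thesis by (simp add: r_def)
qed

end

theory Submission
  imports Defs
begin

text \<open>Lift everything to the nonzero vectors \<open>y\<close> of \<open>\<real>\<^sup>n\<close>. With \<open>X\<close> the set of unit vectors on the lines
  of \<open>N\<close> and \<open>m(y)\<close> the supremum of \<open>y \<bullet> x\<close> over \<open>x \<in> X\<close>, one has \<open>\<alpha> = \<parallel>y\<parallel>\<^sup>2 / (\<parallel>y\<parallel>\<^sup>2 - m(y)\<^sup>2)\<close>, and a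
  closest point of \<open>N\<close> to the line of \<open>y\<close> is spanned by a maximiser \<open>p(y)\<close>. There are two separate
  things to prove: that \<open>\<alpha>\<close> is \<open>C\<^sup>2\<close>, and that its logarithm is convex along the geodesics.

  Regularity. \<open>m\<close> is a support function, so its gradient is \<open>p\<close> as soon as \<open>p\<close> is continuous, and
  it is enough to show that \<open>p\<close> is \<open>C\<^sup>1\<close>. That needs \<open>y\<close> not to be a focal point of \<open>N\<close>, which must
  be extracted from uniqueness of the closest point on an open set. The key is
  \<open>extend_maximiser\<close>: a Brouwer fixed point of \<open>z \<mapsto> y - \<epsilon> p(z)\<close> is a point beyond \<open>y\<close>, seen from
  \<open>p(y)\<close>, that still has \<open>p(y)\<close> as its maximiser. A maximum that survives this prolongation has a negative
  definite second derivative at \<open>y\<close> itself (\<open>critical_nondegenerate\<close>), so the equation of critical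
  points in a \<open>C\<^sup>2\<close> parametrization of \<open>X\<close> can be solved by the inverse function theorem
  (\<open>C1_on_p_near\<close>). As \<open>N\<close> need not be closed, continuity of \<open>p\<close> also has to exclude
  that nearby closest points escape to the boundary of \<open>N\<close>
  (\<open>maximiser_in_closure_unique\<close>). Finally, in the domain of
  unique closest points, \<open>m\<close> vanishes somewhere only if \<open>N\<close> is a single point, and then \<open>m\<^sup>2\<close> is a
  quadratic form.

  Convexity. Fix a time \<open>t\<close> on a geodesic and let \<open>x = p(y(t))\<close>. The function
  \<open>\<parallel>y\<parallel>\<^sup>2 / (\<parallel>y\<parallel>\<^sup>2 - (y \<bullet> x)\<^sup>2)\<close>, which is \<open>\<alpha>\<close> for the single point \<open>x\<close>, lies below \<open>\<alpha>\<close> and touches it at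
  \<open>y(t)\<close>; hence both have the same gradient there, and the geodesic equation, which involves only
  \<open>\<alpha>\<close> and its gradient, gives an explicit nonnegative value for the second derivative of the
  logarithm of the touching function along the curve (\<open>touching_second_derivative\<close>). A continuous
  function that is supported from below in this way is convex by the maximum principle
  (\<open>convex_on_if_supported\<close>).\<close>

section \<open>Continuously differentiable maps\<close>

definition C1_on :: "('a::real_normed_vector \<Rightarrow> 'b::real_normed_vector) \<Rightarrow> 'a set \<Rightarrow> bool" where
  "C1_on f S \<longleftrightarrow> (\<exists>f'. (\<forall>x\<in>S. (f has_derivative blinfun_apply (f' x)) (at x)) \<and> continuous_on S f')"

lemma C2_on_iff: "C2_on f S \<longleftrightarrow>
    (\<exists>f'. (\<forall>x\<in>S. (f has_derivative blinfun_apply (f' x)) (at x)) \<and> C1_on f' S)"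
  unfolding C2_on_def C1_on_def by blast

lemma C1_onI:
  "(\<And>x. x \<in> S \<Longrightarrow> (f has_derivative blinfun_apply (f' x)) (at x)) \<Longrightarrow> continuous_on S f' \<Longrightarrow> C1_on f S"
  unfolding C1_on_def by blast

lemma C2_onI:
  "(\<And>x. x \<in> S \<Longrightarrow> (f has_derivative blinfun_apply (f' x)) (at x)) \<Longrightarrow> C1_on f' S \<Longrightarrow> C2_on f S"
  unfolding C2_on_iff by blast

lemma C1_on_imp_continuous_on: "C1_on f S \<Longrightarrow> continuous_on S f"
  unfolding C1_on_def
  by (meson continuous_at_imp_continuous_on has_derivative_continuous)

lemma C2_on_imp_C1_on: "C2_on f S \<Longrightarrow> C1_on f S"
  unfolding C2_on_iff using C1_on_imp_continuous_on C1_onI by blast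

lemma C1_on_subset: "C1_on f S \<Longrightarrow> T \<subseteq> S \<Longrightarrow> C1_on f T"
  unfolding C1_on_def by (meson continuous_on_subset subsetD)

lemma C2_on_subset: "C2_on f S \<Longrightarrow> T \<subseteq> S \<Longrightarrow> C2_on f T"
  unfolding C2_on_iff by (meson C1_on_subset subsetD)

lemma C1_on_compose:
  assumes "C1_on f S" "C1_on g T" "f ` S \<subseteq> T"
  shows "C1_on (\<lambda>x. g (f x)) S"
proof -
  obtain f' where f': "\<And>x. x \<in> S \<Longrightarrow> (f has_derivative blinfun_apply (f' x)) (at x)" "continuous_on S f'"
    using assms(1) unfolding C1_on_def by blast
  obtain g' where g': "\<And>x. x \<in> T \<Longrightarrow> (g has_derivative blinfun_apply (g' x)) (at x)" "continuous_on T g'"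
    using assms(2) unfolding C1_on_def by blast
  have cf: "continuous_on S f" using assms(1) by (rule C1_on_imp_continuous_on)
  show ?thesis
  proof (rule C1_onI)
    fix x assume x: "x \<in> S"
    have "((\<lambda>x. g (f x)) has_derivative (\<lambda>h. g' (f x) (f' x h))) (at x)"
      using diff_chain_at[OF f'(1)[OF x] g'(1)] x assms(3) by (auto simp: o_def)
    then show "((\<lambda>x. g (f x)) has_derivative blinfun_apply (g' (f x) o\<^sub>L f' x)) (at x)"
      by (simp add: blinfun_compose.rep_eq o_def)
  next
    show "continuous_on S (\<lambda>x. g' (f x) o\<^sub>L f' x)"
      by (intro continuous_intros f'(2) continuous_on_compose2[OF g'(2) cf assms(3)])
  qed
qed

lemma C1_on_bounded_linear: "bounded_linear f \<Longrightarrow> C1_on f S"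
  by (rule C1_onI[where f' = "\<lambda>_. Blinfun f"])
    (auto simp: bounded_linear_Blinfun_apply bounded_linear_imp_has_derivative)

lemma C1_on_linear_image: "bounded_linear g \<Longrightarrow> C1_on f S \<Longrightarrow> C1_on (\<lambda>x. g (f x)) S"
  by (rule C1_on_compose[where T = UNIV]) (auto intro: C1_on_bounded_linear)

lemma C1_on_bilinear:
  assumes "bounded_bilinear prd" and "C1_on f S" "C1_on g S"
  shows "C1_on (\<lambda>x. prd (f x) (g x)) S"
proof -
  interpret bounded_bilinear prd by fact
  obtain f' where f': "\<And>x. x \<in> S \<Longrightarrow> (f has_derivative blinfun_apply (f' x)) (at x)" "continuous_on S f'"
    using assms(2) unfolding C1_on_def by blast
  obtain g' where g': "\<And>x. x \<in> S \<Longrightarrow> (g has_derivative blinfun_apply (g' x)) (at x)" "continuous_on S g'"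
    using assms(3) unfolding C1_on_def by blast
  have c: "continuous_on S f" "continuous_on S g" using assms by (auto intro: C1_on_imp_continuous_on)
  show ?thesis
  proof (rule C1_onI)
    fix x assume x: "x \<in> S"
    show "((\<lambda>x. prd (f x) (g x)) has_derivative
       blinfun_apply ((prod_right (f x) o\<^sub>L g' x) + (prod_left (g x) o\<^sub>L f' x))) (at x)"
      using FDERIV[OF f'(1)[OF x] g'(1)[OF x]]
      by (rule has_derivative_eq_rhs) (auto simp: blinfun.bilinear_simps)
  next
    show "continuous_on S (\<lambda>x. (prod_right (f x) o\<^sub>L g' x) + (prod_left (g x) o\<^sub>L f' x))"
      by (intro continuous_intros f' g' c bounded_linear.continuous_on[OF bounded_linear_prod_left]
          bounded_linear.continuous_on[OF bounded_linear_prod_right])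
  qed
qed

lemma C1_on_const: "C1_on (\<lambda>x. c) S"
  by (rule C1_onI[where f' = "\<lambda>_. 0"]) (auto simp: zero_blinfun.rep_eq)

lemma C1_on_add: "C1_on f S \<Longrightarrow> C1_on g S \<Longrightarrow> C1_on (\<lambda>x. f x + g x) S"
  unfolding C1_on_def
proof (elim exE conjE, intro exI conjI ballI)
  fix f' g' x
  assume "\<forall>x\<in>S. (f has_derivative blinfun_apply (f' x)) (at x)"
    "\<forall>x\<in>S. (g has_derivative blinfun_apply (g' x)) (at x)" "x \<in> S"
  then show "((\<lambda>x. f x + g x) has_derivative blinfun_apply (f' x + g' x)) (at x)"
    by (auto intro!: derivative_eq_intros simp: blinfun.bilinear_simps)
qed (auto intro: continuous_intros)

lemma C1_on_sum: "(\<And>i. i \<in> I \<Longrightarrow> C1_on (f i) S) \<Longrightarrow> C1_on (\<lambda>x. \<Sum>i\<in>I. f i x) S"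
  by (induction I rule: infinite_finite_induct) (auto intro: C1_on_const C1_on_add)

lemma C1_on_diff: "C1_on f S \<Longrightarrow> C1_on g S \<Longrightarrow> C1_on (\<lambda>x. f x - g x) S"
  using C1_on_add[of f S "\<lambda>x. - g x"] C1_on_linear_image[of uminus g S]
  by (simp add: bounded_linear_minus[OF bounded_linear_ident])

lemma C1_on_Pair:
  assumes "C1_on f S" "C1_on g S" shows "C1_on (\<lambda>x. (f x, g x)) S"
proof -
  have *: "bounded_linear (\<lambda>a. (a, 0))" "bounded_linear (\<lambda>b. (0, b))"
    by (auto intro: bounded_linear_Pair bounded_linear_ident bounded_linear_zero)
  show ?thesis
    using C1_on_add[OF C1_on_linear_image[OF *(1) assms(1)] C1_on_linear_image[OF *(2) assms(2)]] by simp
qed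

text \<open>The derivative at a point is unique, so local choices of a derivative agree with the
  Frechet derivative and can be glued.\<close>
lemma C1_on_local:
  assumes "\<And>x. x \<in> S \<Longrightarrow> \<exists>U. open U \<and> x \<in> U \<and> C1_on f U"
  shows "C1_on f S"
proof -
  define f' where "f' x = Blinfun (frechet_derivative f (at x))" for x
  have eq: "f' x = g x" if "(f has_derivative blinfun_apply (g x)) (at x)" for g x
    unfolding f'_def using frechet_derivative_at[OF that] by (metis blinfun_apply_inverse)
  show ?thesis
  proof (rule C1_onI)
    fix x assume x: "x \<in> S"
    then show "(f has_derivative blinfun_apply (f' x)) (at x)"
      using assms[OF x] eq unfolding C1_on_def by metis
  next
    have "isCont f' x" if x: "x \<in> S" for x
    proof -
      obtain U g where U: "open U" "x \<in> U" "continuous_on U g"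
        "\<And>y. y \<in> U \<Longrightarrow> (f has_derivative blinfun_apply (g y)) (at y)"
        using assms[OF x] unfolding C1_on_def by blast
      have "continuous_on U f'"
        using U(3) by (rule continuous_on_eq) (metis eq U(4))
      then show ?thesis using U by (simp add: continuous_on_eq_continuous_at)
    qed
    then show "continuous_on S f'" by (rule continuous_at_imp_continuous_on[rule_format])
  qed
qed

lemma C1_on_cong_open:
  assumes "C1_on f S" "open S" "\<And>x. x \<in> S \<Longrightarrow> f x = g x"
  shows "C1_on g S"
  using assms unfolding C1_on_def by (meson has_derivative_transform_within_open)

lemma C2_on_cong_open:
  assumes "C2_on f S" "open S" "\<And>x. x \<in> S \<Longrightarrow> f x = g x"
  shows "C2_on g S"
  using assms unfolding C2_on_iff by (meson has_derivative_transform_within_open)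

lemma C2_on_compose:
  assumes "C2_on f S" "C2_on g T" "f ` S \<subseteq> T"
  shows "C2_on (\<lambda>x. g (f x)) S"
proof -
  obtain f' where f': "\<And>x. x \<in> S \<Longrightarrow> (f has_derivative blinfun_apply (f' x)) (at x)" "C1_on f' S"
    using assms(1) unfolding C2_on_iff by blast
  obtain g' where g': "\<And>x. x \<in> T \<Longrightarrow> (g has_derivative blinfun_apply (g' x)) (at x)" "C1_on g' T"
    using assms(2) unfolding C2_on_iff by blast
  show ?thesis
  proof (rule C2_onI)
    fix x assume x: "x \<in> S"
    have "((\<lambda>x. g (f x)) has_derivative (\<lambda>h. g' (f x) (f' x h))) (at x)"
      using diff_chain_at[OF f'(1)[OF x] g'(1)] x assms(3) by (auto simp: o_def)
    then show "((\<lambda>x. g (f x)) has_derivative blinfun_apply (g' (f x) o\<^sub>L f' x)) (at x)"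
      by (simp add: blinfun_compose.rep_eq o_def)
  next
    show "C1_on (\<lambda>x. g' (f x) o\<^sub>L f' x) S"
      by (intro C1_on_bilinear[OF bounded_bilinear_blinfun_compose] f'(2)
          C1_on_compose[OF C2_on_imp_C1_on[OF assms(1)] g'(2) assms(3)])
  qed
qed

lemma C2_on_bounded_linear: "bounded_linear f \<Longrightarrow> C2_on f S"
  by (rule C2_onI[where f' = "\<lambda>_. Blinfun f"])
    (auto simp: bounded_linear_Blinfun_apply bounded_linear_imp_has_derivative C1_on_const)

lemma C2_on_id: "C2_on (\<lambda>x. x) S"
  by (rule C2_on_bounded_linear) (rule bounded_linear_ident)

lemma C2_on_bilinear:
  assumes "bounded_bilinear prd" and "C2_on f S" "C2_on g S"
  shows "C2_on (\<lambda>x. prd (f x) (g x)) S"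
proof -
  interpret bounded_bilinear prd by fact
  obtain f' where f': "\<And>x. x \<in> S \<Longrightarrow> (f has_derivative blinfun_apply (f' x)) (at x)" "C1_on f' S"
    using assms(2) unfolding C2_on_iff by blast
  obtain g' where g': "\<And>x. x \<in> S \<Longrightarrow> (g has_derivative blinfun_apply (g' x)) (at x)" "C1_on g' S"
    using assms(3) unfolding C2_on_iff by blast
  show ?thesis
  proof (rule C2_onI)
    fix x assume x: "x \<in> S"
    show "((\<lambda>x. prd (f x) (g x)) has_derivative
       blinfun_apply ((prod_right (f x) o\<^sub>L g' x) + (prod_left (g x) o\<^sub>L f' x))) (at x)"
      using FDERIV[OF f'(1)[OF x] g'(1)[OF x]]
      by (rule has_derivative_eq_rhs) (auto simp: blinfun.bilinear_simps)
  next
    show "C1_on (\<lambda>x. (prod_right (f x) o\<^sub>L g' x) + (prod_left (g x) o\<^sub>L f' x)) S"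
      by (intro C1_on_add C1_on_bilinear[OF bounded_bilinear_blinfun_compose] f' g'
          C1_on_linear_image[OF bounded_linear_prod_left] C1_on_linear_image[OF bounded_linear_prod_right]
          C2_on_imp_C1_on assms)
  qed
qed

lemma C2_on_diff:
  assumes "C2_on f S" "C2_on g S" shows "C2_on (\<lambda>x. f x - g x) S"
proof -
  obtain f' where f': "\<And>x. x \<in> S \<Longrightarrow> (f has_derivative blinfun_apply (f' x)) (at x)" "C1_on f' S"
    using assms(1) unfolding C2_on_iff by blast
  obtain g' where g': "\<And>x. x \<in> S \<Longrightarrow> (g has_derivative blinfun_apply (g' x)) (at x)" "C1_on g' S"
    using assms(2) unfolding C2_on_iff by blast
  show ?thesis
  proof (rule C2_onI)
    show "((\<lambda>x. f x - g x) has_derivative blinfun_apply (f' x - g' x)) (at x)" if "x \<in> S" for x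
      using f'(1)[OF that] g'(1)[OF that]
      by (auto intro!: derivative_eq_intros simp: blinfun.bilinear_simps)
  qed (intro C1_on_diff f' g')
qed

lemma C2_on_real:
  fixes \<phi> :: "real \<Rightarrow> real"
  assumes "\<And>x. x \<in> S \<Longrightarrow> (\<phi> has_real_derivative \<phi>a x) (at x)"
    "\<And>x. x \<in> S \<Longrightarrow> (\<phi>a has_real_derivative \<phi>b x) (at x)" "continuous_on S \<phi>b"
  shows "C2_on \<phi> S"
proof (rule C2_onI)
  have c: "C1_on \<phi>a S"
  proof (rule C1_onI)
    show "(\<phi>a has_derivative blinfun_apply (blinfun_scaleR_left (\<phi>b x))) (at x)" if "x \<in> S" for x
      using assms(2)[OF that] by (simp add: has_field_derivative_def mult_commute_abs)
  qed (intro bounded_linear.continuous_on[OF bounded_linear_blinfun_scaleR_left] assms)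
  show "(\<phi> has_derivative blinfun_apply (blinfun_scaleR_left (\<phi>a x))) (at x)" if "x \<in> S" for x
    using assms(1)[OF that] by (simp add: has_field_derivative_def mult_commute_abs)
  show "C1_on (\<lambda>x. blinfun_scaleR_left (\<phi>a x)) S"
    by (rule C1_on_linear_image[OF bounded_linear_blinfun_scaleR_left c])
qed

lemma C2_on_inverse_real: "C2_on (inverse :: real \<Rightarrow> real) {0<..}"
proof (rule C2_on_real[where \<phi>a = "\<lambda>x. - ((inverse x) ^ 2)" and \<phi>b = "\<lambda>x. 2 * (inverse x) ^ 3"])
  fix x :: real assume "x \<in> {0<..}"
  then have "x \<noteq> 0" by simp
  note d = DERIV_inverse[OF this, of UNIV]
  show "(inverse has_real_derivative - ((inverse x) ^ 2)) (at x)"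
    using d by (simp add: power2_eq_square)
  show "((\<lambda>x. - ((inverse x) ^ 2)) has_real_derivative 2 * (inverse x) ^ 3) (at x)"
    by (rule DERIV_cong[OF DERIV_minus[OF DERIV_power[OF d, of 2]]])
      (simp add: power2_eq_square power3_eq_cube)
qed (auto intro!: continuous_intros)

lemma C2_on_sqrt: "C2_on sqrt {0<..}"
proof (rule C2_on_real[where \<phi>a = "\<lambda>x. inverse (sqrt x) / 2" and \<phi>b = "\<lambda>x. - ((inverse (sqrt x)) ^ 3) / 4"])
  fix x :: real assume "x \<in> {0<..}"
  then have x: "0 < x" by simp
  note d = DERIV_real_sqrt[OF x]
  show "(sqrt has_real_derivative inverse (sqrt x) / 2) (at x)" by (rule d)
  have "sqrt x \<noteq> 0" using x by simp
  have "((\<lambda>x. inverse (sqrt x)) has_real_derivative - (inverse (sqrt x) / 2 * inverse ((sqrt x) ^ Suc (Suc 0)))) (at x)"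
    by (rule DERIV_inverse_fun[OF d \<open>sqrt x \<noteq> 0\<close>])
  from DERIV_cdivide[OF this, of 2]
  show "((\<lambda>x. inverse (sqrt x) / 2) has_real_derivative - ((inverse (sqrt x)) ^ 3) / 4) (at x)"
    by (rule DERIV_cong) (simp add: power_inverse[symmetric] power3_eq_cube power2_eq_square del: real_sqrt_pow2_iff real_sqrt_mult_self power_inverse)
qed (auto intro!: continuous_intros)

text \<open>An injective operator on a finite-dimensional space is bounded below, and so, uniformly, are
  all operators close to it; this controls the error of solutions of a perturbed equation.\<close>
lemma isCont_solution:
  fixes A :: "'a::metric_space \<Rightarrow> 'b::euclidean_space \<Rightarrow>\<^sub>L 'c::euclidean_space"
  assumes A: "isCont A x0" and inj: "inj (blinfun_apply (A x0))"
    and c: "isCont c x0" and eq: "\<forall>\<^sub>F x in nhds x0. A x (v x) = c x"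
  shows "isCont v x0"
proof -
  obtain k where k: "k > 0" "\<And>w. k * norm w \<le> norm (A x0 w)"
    using linear_inj_bounded_below_pos[of "blinfun_apply (A x0)"] inj
    by (metis blinfun.bounded_linear_right bounded_linear.linear mult.commute)
  have "\<forall>\<^sub>F x in at x0. norm (v x - v x0) \<le> (2 / k) * norm (c x - A x (v x0))"
  proof -
    have "\<forall>\<^sub>F x in at x0. dist (A x) (A x0) < k / 2"
      using tendstoD[OF A[unfolded isCont_def], of "k / 2"] k(1) by simp
    moreover have "\<forall>\<^sub>F x in at x0. A x (v x) = c x"
      using eq by (auto simp: eventually_nhds_conv_at)
    ultimately show ?thesis
    proof eventually_elim
      case (elim x)
      define w where "w = v x - v x0"
      have "k * norm w \<le> norm (A x0 w)" by (rule k)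
      also have "A x0 w = A x w - (A x - A x0) w" by (simp add: blinfun.bilinear_simps)
      also have "norm \<dots> \<le> norm (A x w) + norm ((A x - A x0) w)" by (rule norm_triangle_ineq4)
      also have "norm ((A x - A x0) w) \<le> norm (A x - A x0) * norm w" by (rule norm_blinfun)
      also have "\<dots> \<le> k / 2 * norm w"
        using elim(1) by (intro mult_right_mono) (auto simp: dist_norm)
      finally have "k / 2 * norm w \<le> norm (A x w)" by simp
      moreover have "A x w = c x - A x (v x0)"
        unfolding w_def blinfun.bilinear_simps elim(2) by (rule refl)
      ultimately have "k / 2 * norm (v x - v x0) \<le> norm (c x - A x (v x0))"
        by (simp only: w_def)
      then show ?case using k(1) by (simp add: field_simps)
    qed
  qed
  moreover have "((\<lambda>x. (2 / k) * norm (c x - A x (v x0))) \<longlongrightarrow> (2/k) * norm (c x0 - A x0 (v x0))) (at x0)"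
    using A c unfolding isCont_def by (intro tendsto_intros)
  moreover have "A x0 (v x0) = c x0" using eq by (rule eventually_nhds_x_imp_x)
  ultimately have "((\<lambda>x. v x - v x0) \<longlongrightarrow> 0) (at x0)"
    by (intro Lim_null_comparison[of "\<lambda>x. v x - v x0"]) auto
  then show ?thesis unfolding isCont_def by (simp add: LIM_zero_iff)
qed

text \<open>The inverse function theorem with continuity of the derivative of the inverse: its values
  solve a linear equation with continuously varying invertible operator.\<close>
lemma local_C1_inverse:
  fixes f :: "'a::euclidean_space \<Rightarrow> 'a"
  assumes "open U" and derf: "\<And>x. x \<in> U \<Longrightarrow> (f has_derivative blinfun_apply (f' x)) (at x)"
    and contf: "continuous_on U f'" and "x0 \<in> U" and inj: "inj (blinfun_apply (f' x0))"
  obtains U' V g where "open U'" "U' \<subseteq> U" "x0 \<in> U'" "open V" "f x0 \<in> V" "homeomorphism U' V f g" "C1_on g V"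
proof -
  have "linear (blinfun_apply (f' x0))" by (simp add: blinfun.bounded_linear_right bounded_linear.linear)
  then obtain h where h: "linear h" "h \<circ> blinfun_apply (f' x0) = id"
    using inj linear_injective_left_inverse by blast
  have inv: "Blinfun h o\<^sub>L f' x0 = id_blinfun"
    using h by (intro blinfun_eqI) (auto simp: bounded_linear_Blinfun_apply linear_conv_bounded_linear fun_eq_iff)
  obtain U' V g g' where g: "open U'" "U' \<subseteq> U" "x0 \<in> U'" "open V" "f x0 \<in> V" "homeomorphism U' V f g"
    "\<And>y. y \<in> V \<Longrightarrow> (g has_derivative (g' y)) (at y)"
    "\<And>y. y \<in> V \<Longrightarrow> g' y = inv (blinfun_apply (f'(g y)))"
    "\<And>y. y \<in> V \<Longrightarrow> bij (blinfun_apply (f'(g y)))"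
    by (rule inverse_function_theorem[OF assms(1-4) inv], assumption, rule that)
  have gU: "g y \<in> U" if "y \<in> V" for y
    using g(2,6) that by (auto simp: homeomorphism_def)
  have bl: "blinfun_apply (Blinfun (g' y)) = g' y" if "y \<in> V" for y
    using g(7)[OF that] by (simp add: bounded_linear_Blinfun_apply has_derivative_bounded_linear)
  have "C1_on g V"
  proof (rule C1_onI)
    show "(g has_derivative blinfun_apply (Blinfun (g' y))) (at y)" if "y \<in> V" for y
      using g(7)[OF that] bl[OF that] by simp
    have "isCont (\<lambda>y. blinfun_apply (Blinfun (g' y)) i) y0" if y0: "y0 \<in> V" for i y0
    proof (rule isCont_solution)
      have "continuous_on V g" using g(6) by (simp add: homeomorphism_def)
      then have "continuous_on V (\<lambda>y. f' (g y))"
        by (rule continuous_on_compose2[OF contf]) (use gU in auto)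
      then show "isCont (\<lambda>y. f' (g y)) y0"
        using y0 g(4) by (simp add: continuous_on_eq_continuous_at)
      show "inj (blinfun_apply (f' (g y0)))" using g(9)[OF y0] by (rule bij_is_inj)
      show "isCont (\<lambda>_. i) y0" by simp
      have "f' (g y) (Blinfun (g' y) i) = i" if "y \<in> V" for y
        using g(8,9) that bl by (simp add: bij_is_surj surj_f_inv_f)
      then show "\<forall>\<^sub>F y in nhds y0. f' (g y) (Blinfun (g' y) i) = i"
        using eventually_nhds y0 g(4) by blast
    qed
    then show "continuous_on V (\<lambda>y. Blinfun (g' y))"
      by (intro continuous_on_blinfun_componentwise continuous_at_imp_continuous_on) auto
  qed
  with g show ?thesis using that by blast
qed

section \<open>Unique maximisers of linear functionals on a set of unit vectors\<close>

lemma second_deriv_nonpos_at_max: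
  fixes f :: "real \<Rightarrow> real"
  assumes d: "d > 0" and f: "\<And>s. \<bar>s - t\<bar> < d \<Longrightarrow> (f has_real_derivative f' s) (at s)"
    and f': "(f' has_real_derivative c) (at t)"
    and max: "\<And>s. \<bar>s - t\<bar> < d \<Longrightarrow> f s \<le> f t"
  shows "c \<le> 0"
proof (rule ccontr)
  assume "\<not> c \<le> 0"
  then have c: "c > 0" by simp
  have f't: "f' t = 0"
    by (rule DERIV_local_max[OF f[of t] d]) (use d max in \<open>auto simp: abs_minus_commute\<close>)
  obtain e where e: "e > 0" "\<And>h. 0 < h \<Longrightarrow> h < e \<Longrightarrow> f' t < f' (t + h)"
    using DERIV_pos_inc_right[OF f' c] by blast
  define s where "s = t + min d e / 2"
  have s: "t < s" "s - t < d" "s - t < e" using d e(1) by (auto simp: s_def)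
  obtain z where z: "t < z" "z < s" "f s - f t = (s - t) * f' z"
    using MVT2[of t s f f'] f s by force
  have "f' z > 0" using e(2)[of "z - t"] z s f't by simp
  then have "f s - f t > 0" using z s by simp
  then show False using max[of s] s by simp
qed

text \<open>In the application \<open>X\<close> consists of the unit vectors on the lines of a submanifold, and maximising
  \<open>y \<bullet> x\<close> selects a closest line. The set \<open>X\<close> need not be closed.\<close>
locale unique_maximiser =
  fixes X :: "'a::euclidean_space set" and D :: "'a set" and p :: "'a \<Rightarrow> 'a"
  assumes unit: "x \<in> X \<Longrightarrow> norm x = 1"
    and open_D: "open D"
    and p_mem: "y \<in> D \<Longrightarrow> p y \<in> X"
    and p_max: "y \<in> D \<Longrightarrow> x \<in> X \<Longrightarrow> x \<noteq> p y \<Longrightarrow> y \<bullet> x < y \<bullet> p y"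
begin

lemma p_ge: "y \<in> D \<Longrightarrow> x \<in> X \<Longrightarrow> y \<bullet> x \<le> y \<bullet> p y"
  using p_max[of y x] by (cases "x = p y") auto

lemma p_eqI: "y \<in> D \<Longrightarrow> x \<in> X \<Longrightarrow> y \<bullet> p y \<le> y \<bullet> x \<Longrightarrow> x = p y"
  using p_max[of y x] by force

lemma unit_inner: "x \<in> X \<Longrightarrow> x \<bullet> x = 1"
  using unit[of x] by (simp add: norm_eq_1)

lemma norm_closure: "q \<in> closure X \<Longrightarrow> norm q = 1"
proof -
  have "closure X \<subseteq> sphere 0 1" using unit by (intro closure_minimal) auto
  then show "q \<in> closure X \<Longrightarrow> norm q = 1" by auto
qed

text \<open>A limit \<open>q\<close> of points of \<open>X\<close> that is as good as the maximiser becomes the only candidate after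
  moving from \<open>y\<close> towards \<open>q\<close>. The moved point still lies in \<open>D\<close> and so has its maximiser in \<open>X\<close>,
  which forces \<open>q \<in> X\<close>.\<close>
lemma maximiser_in_closure_unique:
  assumes y: "y \<in> D" and q: "q \<in> closure X" and ge: "y \<bullet> p y \<le> y \<bullet> q"
  shows "q = p y"
proof -
  have nq: "norm q = 1" using q by (rule norm_closure)
  have qq: "q \<bullet> q = 1" using nq by (simp add: norm_eq_1)
  obtain e where e: "e > 0" "cball y e \<subseteq> D" using open_D y open_contains_cball by blast
  define z where "z = y + e *\<^sub>R q"
  have "z \<in> cball y e" using e nq by (simp add: z_def dist_norm)
  then have zD: "z \<in> D" using e by blast
  have "z \<bullet> p z - z \<bullet> q \<ge> 0"
    using _ q by (rule continuous_ge_on_closure) (use p_ge[OF zD] in \<open>auto intro!: continuous_intros\<close>)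
  then have 1: "y \<bullet> q + e \<le> y \<bullet> p z + e * (q \<bullet> p z)"
    using qq by (simp add: z_def inner_add_left)
  have pz: "p z \<in> X" "norm (p z) = 1" using p_mem[OF zD] unit by auto
  have 2: "y \<bullet> p z \<le> y \<bullet> q" using p_ge[OF y pz(1)] ge by simp
  have 3: "q \<bullet> p z \<le> 1" using Cauchy_Schwarz_ineq2[of q "p z"] nq pz by simp
  have "e * 1 \<le> e * (q \<bullet> p z)" using 1 2 by linarith
  then have "1 \<le> q \<bullet> p z" using e(1) by (rule mult_left_le_imp_le)
  with 3 have "q \<bullet> p z = norm q * norm (p z)" using nq pz(2) by simp
  then have "q = p z" unfolding norm_cauchy_schwarz_eq using nq pz(2) by simp
  then show ?thesis using p_eqI[OF y pz(1)] ge by simp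
qed

text \<open>By compactness of the closure of \<open>X\<close>, all points at least \<open>\<epsilon>\<close> away from the maximiser are worse
  by a definite amount, and this survives a small change of the functional.\<close>
lemma isCont_p:
  assumes y0: "y0 \<in> D" shows "isCont p y0"
  unfolding isCont_def
proof (rule tendstoI)
  fix \<epsilon> :: real assume \<epsilon>: "\<epsilon> > 0"
  define K where "K = closure X - ball (p y0) \<epsilon>"
  have "bounded X" using unit by (auto simp: bounded_iff)
  then have cK: "compact K" unfolding K_def by (simp add: compact_closure compact_diff)
  have "\<exists>\<delta>>0. \<forall>x\<in>K. y0 \<bullet> x \<le> y0 \<bullet> p y0 - \<delta>"
  proof (cases "K = {}")
    case True then show ?thesis by (intro exI[of _ 1]) auto
  next
    case False
    have "continuous_on K (\<lambda>x. y0 \<bullet> x)" by (intro continuous_intros)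
    then obtain q where q: "q \<in> K" "\<And>x. x \<in> K \<Longrightarrow> y0 \<bullet> x \<le> y0 \<bullet> q"
      using continuous_attains_sup[OF cK False] by blast
    have "q \<noteq> p y0" "q \<in> closure X" using q \<epsilon> by (auto simp: K_def)
    then have "y0 \<bullet> q < y0 \<bullet> p y0" using maximiser_in_closure_unique[OF y0] by force
    then show ?thesis using q(2) by (intro exI[of _ "y0 \<bullet> p y0 - y0 \<bullet> q"]) auto
  qed
  then obtain \<delta> where \<delta>: "\<delta> > 0" "\<And>x. x \<in> K \<Longrightarrow> y0 \<bullet> x \<le> y0 \<bullet> p y0 - \<delta>" by blast
  have "\<forall>\<^sub>F y in at y0. y \<in> ball y0 (\<delta>/2) \<inter> D"
    using \<delta> y0 open_D by (intro eventually_at_in_open') auto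
  then show "\<forall>\<^sub>F y in at y0. dist (p y) (p y0) < \<epsilon>"
  proof eventually_elim
    case (elim y)
    have pX: "p y \<in> X" "p y0 \<in> X" using elim y0 p_mem by auto
    have le: "\<bar>(y - y0) \<bullet> x\<bar> < \<delta> / 2" if "x \<in> X" for x
    proof -
      have "\<bar>(y - y0) \<bullet> x\<bar> \<le> norm (y - y0) * norm x" by (rule Cauchy_Schwarz_ineq2)
      also have "\<dots> < \<delta> / 2" using elim unit[OF that] by (simp add: dist_norm norm_minus_commute)
      finally show ?thesis .
    qed
    have "y \<bullet> p y0 \<le> y \<bullet> p y" using elim pX p_ge by blast
    then have "y0 \<bullet> p y > y0 \<bullet> p y0 - \<delta>"
      using le[OF pX(1)] le[OF pX(2)] unfolding inner_diff_left by linarith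
    then have "p y \<notin> K" using \<delta>(2) by force
    then show ?case using pX(1) closure_subset by (auto simp: K_def dist_commute)
  qed
qed

lemma continuous_on_p: "continuous_on D p"
  by (intro continuous_at_imp_continuous_on ballI isCont_p)

text \<open>The point \<open>y0\<close> can be pushed away from its maximiser without changing the maximiser: a fixed point
  \<open>z = y0 - e p(z)\<close> exists by Brouwer's theorem, and \<open>p(z)\<close> also maximises \<open>y0 = z + e p(z)\<close> because
  adding \<open>e p(z)\<close> favours \<open>p(z)\<close> over every other unit vector.\<close>
lemma extend_maximiser:
  assumes y0: "y0 \<in> D"
  obtains \<mu> where "\<mu> > 0" "y0 - \<mu> *\<^sub>R p y0 \<in> D" "p (y0 - \<mu> *\<^sub>R p y0) = p y0"
proof -
  obtain e where e: "e > 0" "cball y0 e \<subseteq> D" using open_D y0 open_contains_cball by blast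
  have "(\<lambda>z. y0 - e *\<^sub>R p z) \<in> cball y0 e \<rightarrow> cball y0 e"
    using e p_mem unit by (force simp: dist_norm)
  moreover have "continuous_on (cball y0 e) (\<lambda>z. y0 - e *\<^sub>R p z)"
    by (intro continuous_intros continuous_on_subset[OF continuous_on_p] e)
  ultimately obtain z where z: "z \<in> cball y0 e" "y0 - e *\<^sub>R p z = z"
    using brouwer_ball[OF e(1)] by metis
  have zD: "z \<in> D" using z e by blast
  have y0z: "y0 = z + e *\<^sub>R p z" using z(2) by (metis diff_add_cancel)
  have pX: "p z \<in> X" "p y0 \<in> X" using zD y0 p_mem by auto
  have "p y0 \<bullet> p z \<le> 1"
    using norm_cauchy_schwarz[of "p y0" "p z"] pX unit by simp
  then have "e * (p z \<bullet> p y0) \<le> e" using e by (simp add: inner_commute)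
  moreover have "z \<bullet> p y0 \<le> z \<bullet> p z" using p_ge[OF zD pX(2)] .
  moreover have "y0 \<bullet> p y0 = z \<bullet> p y0 + e * (p z \<bullet> p y0)" "y0 \<bullet> p z = z \<bullet> p z + e"
    using arg_cong[OF y0z, of "\<lambda>v. v \<bullet> p y0"] arg_cong[OF y0z, of "\<lambda>v. v \<bullet> p z"]
    by (simp_all add: inner_add_left unit_inner[OF pX(1)])
  ultimately have "y0 \<bullet> p y0 \<le> y0 \<bullet> p z" by simp
  then have "p z = p y0" using p_eqI[OF y0 pX(1)] by simp
  then show ?thesis using that[of e] e zD z(2) by simp
qed

text \<open>The maximal value is a supremum of linear functionals, so \<open>p y0\<close> is a subgradient at \<open>y0\<close>; the
  subgradient at a nearby \<open>y\<close> bounds the error from the other side, and continuity of \<open>p\<close> closes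
  the gap.\<close>
lemma max_value_has_derivative:
  assumes y0: "y0 \<in> D"
  shows "((\<lambda>y. y \<bullet> p y) has_derivative (\<lambda>h. h \<bullet> p y0)) (at y0)"
proof -
  obtain e where e: "e > 0" "ball y0 e \<subseteq> D" using open_D y0 open_contains_ball by blast
  show ?thesis
  proof (rule has_derivativeI_sandwich[OF e(1)])
    show "bounded_linear (\<lambda>h. h \<bullet> p y0)" by (rule bounded_linear_inner_left)
    show "((\<lambda>y. norm (p y - p y0)) \<longlongrightarrow> 0) (at y0)"
      using isCont_p[OF y0] by (simp add: isCont_def LIM_zero tendsto_norm_zero)
    fix y assume y: "y \<noteq> y0" "dist y y0 < e"
    then have yD: "y \<in> D" using e by (auto simp: dist_commute)
    have "0 \<le> y \<bullet> p y - y \<bullet> p y0" using p_ge[OF yD p_mem[OF y0]] by simp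
    moreover have "y \<bullet> p y - y \<bullet> p y0 \<le> (y - y0) \<bullet> (p y - p y0)"
      using p_ge[OF y0 p_mem[OF yD]] by (simp add: inner_diff_left inner_diff_right)
    moreover have "(y - y0) \<bullet> (p y - p y0) \<le> norm (y - y0) * norm (p y - p y0)"
      by (rule norm_cauchy_schwarz)
    moreover have "y \<bullet> p y - y0 \<bullet> p y0 - (y - y0) \<bullet> p y0 = y \<bullet> p y - y \<bullet> p y0"
      by (simp add: inner_diff_left)
    ultimately have "norm (y \<bullet> p y - y0 \<bullet> p y0 - (y - y0) \<bullet> p y0) \<le> norm (y - y0) * norm (p y - p y0)"
      by simp
    then show "norm (y \<bullet> p y - y0 \<bullet> p y0 - (y - y0) \<bullet> p y0) / norm (y - y0) \<le> norm (p y - p y0)"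
      using y by (simp add: divide_le_eq mult.commute)
  qed
qed

lemma C2_on_max_value:
  assumes "C1_on p D" shows "C2_on (\<lambda>y. y \<bullet> p y) D"
proof (rule C2_onI)
  show "((\<lambda>y. y \<bullet> p y) has_derivative blinfun_apply (blinfun_inner_left (p y))) (at y)" if "y \<in> D" for y
    using max_value_has_derivative[OF that] by simp
  show "C1_on (\<lambda>y. blinfun_inner_left (p y)) D"
    by (rule C1_on_linear_image[OF bounded_linear_blinfun_inner_left assms])
qed

end

section \<open>Smoothness of the maximiser\<close>

text \<open>The parametrization \<open>\<xi>\<close> of \<open>X\<close> near \<open>x0\<close> is defined on an open subset of the whole space but only
  its restriction to the subspace \<open>T\<close> has to take values in \<open>X\<close>. This keeps the parameter space
  independent of the dimension of \<open>X\<close>. The differentiable map \<open>l\<close> reads off the parameter and makes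
  \<open>\<xi>\<close>, restricted to \<open>T\<close>, an immersion at the parameter of \<open>x0\<close>.\<close>
definition C2_parametrized_at :: "'a::euclidean_space set \<Rightarrow> 'a \<Rightarrow> bool" where
  "C2_parametrized_at X x0 \<longleftrightarrow> (\<exists>W T (\<xi> :: 'a \<Rightarrow> 'a) (l :: 'a \<Rightarrow> 'a) A.
     open W \<and> subspace T \<and> C2_on \<xi> W \<and> \<xi> ` (W \<inter> T) \<subseteq> X \<and> (\<forall>w\<in>W \<inter> T. l (\<xi> w) = w) \<and>
     open A \<and> x0 \<in> A \<and> l differentiable (at x0) \<and>
     (\<forall>x\<in>A \<inter> X. l x \<in> W \<inter> T \<and> \<xi> (l x) = x))"

lemma line_deriv:
  assumes "(f has_derivative f') (at (u + s *\<^sub>R k))"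
  shows "((\<lambda>s. f (u + s *\<^sub>R k)) has_derivative (\<lambda>h. h *\<^sub>R f' k)) (at s)"
proof -
  have "((\<lambda>s. u + s *\<^sub>R k) has_derivative (\<lambda>h. h *\<^sub>R k)) (at s)"
    by (auto intro!: derivative_eq_intros)
  from diff_chain_at[OF this assms]
  have "((\<lambda>s. f (u + s *\<^sub>R k)) has_derivative (\<lambda>h. f' (h *\<^sub>R k))) (at s)" by (simp add: o_def)
  then show ?thesis
    using has_derivative_linear[OF assms] by (simp add: linear_scale)
qed

lemma sum_orthonormal_basis:
  fixes w :: "'a::euclidean_space"
  assumes orth: "pairwise orthogonal B" and unit: "\<And>b. b \<in> B \<Longrightarrow> norm b = 1" 
    and fin: "finite B" and w: "w \<in> span B"
  shows "(\<Sum>b\<in>B. (w \<bullet> b) *\<^sub>R b) = w"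
proof -
  define r where "r = w - (\<Sum>b\<in>B. (w \<bullet> b) *\<^sub>R b)"
  have "r \<in> span B"
    unfolding r_def by (intro span_diff w span_sum span_scale span_base)
  moreover have "orthogonal r b" if b: "b \<in> B" for b
  proof -
    have "(\<Sum>b'\<in>B. (w \<bullet> b') * (b' \<bullet> b)) = (\<Sum>b'\<in>B. if b' = b then w \<bullet> b else 0)"
      using orth unit b by (intro sum.cong refl) (auto simp: pairwise_def orthogonal_def norm_eq_1)
    also have "\<dots> = w \<bullet> b" using fin b by simp
    finally show ?thesis by (simp add: r_def orthogonal_def inner_diff_left inner_sum_left)
  qed
  ultimately have "orthogonal r r" by (rule orthogonal_to_span)
  then show ?thesis by (simp add: r_def orthogonal_self)
qed

context unique_maximiser
begin

text \<open>The second derivative of \<open>y0 \<bullet> \<xi>\<close> at \<open>u0\<close> in a nonzero direction \<open>k \<in> T\<close> is negative. With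
  \<open>z = y0 - \<mu> x0\<close> the prolonged point, the second derivative of \<open>z \<bullet> \<xi>\<close> is at most \<open>0\<close> because \<open>z\<close> has
  the same maximiser, while that of \<open>\<mu> x0 \<bullet> \<xi>\<close> equals \<open>- \<mu> \<parallel>\<xi>' k\<parallel>\<^sup>2\<close> because \<open>\<xi>\<close> is unit along \<open>T\<close>.
  So a vanishing second derivative gives \<open>\<xi>' k = 0\<close>, and then \<open>k = 0\<close> by means of the left
  inverse.\<close>
lemma critical_nondegenerate:
  fixes \<xi> l :: "'a \<Rightarrow> 'a"
  assumes y0: "y0 \<in> D" and x0: "p y0 = x0" and W: "open W" and T: "subspace T"
    and d1: "\<And>w. w \<in> W \<Longrightarrow> (\<xi> has_derivative blinfun_apply (\<xi>' w)) (at w)"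
    and d2: "\<And>w. w \<in> W \<Longrightarrow> (\<xi>' has_derivative blinfun_apply (\<xi>'' w)) (at w)"
    and X: "\<xi> ` (W \<inter> T) \<subseteq> X" and l: "\<And>w. w \<in> W \<inter> T \<Longrightarrow> l (\<xi> w) = w"
    and dl: "l differentiable (at x0)"
    and u0: "u0 \<in> W \<inter> T" "\<xi> u0 = x0"
    and k: "k \<in> T" and zero: "y0 \<bullet> \<xi>'' u0 k k = 0"
  shows "k = 0"
proof -
  obtain \<mu> where \<mu>: "\<mu> > 0" "y0 - \<mu> *\<^sub>R x0 \<in> D" "p (y0 - \<mu> *\<^sub>R x0) = x0"
    using extend_maximiser[OF y0] x0 by metis
  define z where "z = y0 - \<mu> *\<^sub>R x0"
  define g where "g s = u0 + s *\<^sub>R k" for s :: real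
  obtain e where e: "e > 0" "\<And>s. \<bar>s\<bar> < e \<Longrightarrow> g s \<in> W \<inter> T"
  proof -
    have "open (g -` W)" unfolding g_def by (intro open_vimage W continuous_intros)
    moreover have "0 \<in> g -` W" using u0 by (simp add: g_def)
    ultimately obtain e where "e > 0" "ball 0 e \<subseteq> g -` W" using open_contains_ball by blast
    moreover have "g s \<in> T" for s
      using T k u0 by (auto simp: g_def intro: subspace_add subspace_scale)
    ultimately show ?thesis using that[of e] by (auto simp: subset_iff dist_norm)
  qed
  have dg: "((\<lambda>s. \<xi> (g s)) has_derivative (\<lambda>h. h *\<^sub>R \<xi>' (g s) k)) (at s)" if "\<bar>s\<bar> < e" for s
    unfolding g_def by (rule line_deriv) (use d1 e(2)[OF that] in \<open>auto simp: g_def\<close>)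
  have dg': "((\<lambda>s. \<xi>' (g s) k) has_derivative (\<lambda>h. h *\<^sub>R \<xi>'' u0 k k)) (at 0)"
  proof -
    have "((\<lambda>s. \<xi>' (g s)) has_derivative (\<lambda>h. h *\<^sub>R \<xi>'' u0 k)) (at 0)"
      unfolding g_def by (rule line_deriv) (use d2 u0 in \<open>auto simp: g_def\<close>)
    from bounded_linear.has_derivative[OF blinfun.bounded_linear_left this]
    show ?thesis by (simp add: blinfun.scaleR_left)
  qed
  have inner_deriv: "((\<lambda>s. c \<bullet> f s) has_real_derivative c \<bullet> v) (at s)"
    if "(f has_derivative (\<lambda>h. h *\<^sub>R v)) (at s)" for c v :: 'a and f s
    using bounded_linear.has_derivative[OF bounded_linear_inner_right that, of c]
    by (simp add: has_field_derivative_def mult_commute_abs)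
  have in_X: "\<xi> (g s) \<in> X" if "\<bar>s\<bar> < e" for s using e(2)[OF that] X by blast
  have g0: "g 0 = u0" by (simp add: g_def)
  have "z \<bullet> \<xi>'' u0 k k \<le> 0"
  proof (rule second_deriv_nonpos_at_max[OF e(1), where f = "\<lambda>s. z \<bullet> \<xi> (g s)" and t = 0])
    show "((\<lambda>s. z \<bullet> \<xi>' (g s) k) has_real_derivative z \<bullet> \<xi>'' u0 k k) (at 0)"
      by (rule inner_deriv[OF dg'])
    show "((\<lambda>s. z \<bullet> \<xi> (g s)) has_real_derivative z \<bullet> \<xi>' (g s) k) (at s)" if "\<bar>s - 0\<bar> < e" for s
      by (rule inner_deriv[OF dg]) (use that in simp)
    show "z \<bullet> \<xi> (g s) \<le> z \<bullet> \<xi> (g 0)" if "\<bar>s - 0\<bar> < e" for s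
      using p_ge[OF \<mu>(2) in_X] that \<mu>(3) u0 g0 by (simp add: z_def)
  qed
  moreover have "x0 \<bullet> \<xi>'' u0 k k = - (norm (\<xi>' u0 k))\<^sup>2"
  proof -
    \<comment> \<open>differentiate \<open>\<xi> \<bullet> \<xi> = 1\<close> twice along the line \<open>g\<close>\<close>
    have orth: "\<xi> (g s) \<bullet> \<xi>' (g s) k = 0" if s: "\<bar>s\<bar> < e" for s
    proof -
      have "((\<lambda>s. \<xi> (g s) \<bullet> \<xi> (g s)) has_derivative
          (\<lambda>h. \<xi> (g s) \<bullet> (h *\<^sub>R \<xi>' (g s) k) + (h *\<^sub>R \<xi>' (g s) k) \<bullet> \<xi> (g s))) (at s)"
        by (rule has_derivative_inner[OF dg[OF s] dg[OF s]])
      moreover have "((\<lambda>s. \<xi> (g s) \<bullet> \<xi> (g s)) has_derivative (\<lambda>h. 0)) (at s)"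
        by (rule has_derivative_transform_within_open[where f = "\<lambda>_. 1" and s = "{-e<..<e}"])
          (use s unit_inner[OF in_X] in auto)
      ultimately have "(\<lambda>h. \<xi> (g s) \<bullet> (h *\<^sub>R \<xi>' (g s) k) + (h *\<^sub>R \<xi>' (g s) k) \<bullet> \<xi> (g s)) = (\<lambda>h. 0)"
        by (rule has_derivative_unique)
      from fun_cong[OF this, of 1] show ?thesis by (simp add: inner_commute)
    qed
    have "((\<lambda>s. \<xi> (g s) \<bullet> \<xi>' (g s) k) has_derivative
        (\<lambda>h. \<xi> (g 0) \<bullet> (h *\<^sub>R \<xi>'' u0 k k) + (h *\<^sub>R \<xi>' (g 0) k) \<bullet> \<xi>' (g 0) k)) (at 0)"
      by (rule has_derivative_inner[OF dg dg']) (use e in simp)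
    moreover have "((\<lambda>s. \<xi> (g s) \<bullet> \<xi>' (g s) k) has_derivative (\<lambda>h. 0)) (at 0)"
      by (rule has_derivative_transform_within_open[where f = "\<lambda>_. 0" and s = "{-e<..<e}"])
        (use e orth in auto)
    ultimately have "(\<lambda>h. \<xi> (g 0) \<bullet> (h *\<^sub>R \<xi>'' u0 k k) + (h *\<^sub>R \<xi>' (g 0) k) \<bullet> \<xi>' (g 0) k) = (\<lambda>h. 0)"
      by (rule has_derivative_unique)
    from fun_cong[OF this, of 1] show ?thesis
      using u0 by (simp add: g0 power2_norm_eq_inner)
  qed
  ultimately have "\<mu> * (norm (\<xi>' u0 k))\<^sup>2 \<le> 0"
    using zero by (simp add: z_def inner_diff_left)
  then have k0: "\<xi>' u0 k = 0" using \<mu>(1) by (simp add: mult_le_0_iff)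
  obtain l' where l': "(l has_derivative l') (at x0)" using dl unfolding differentiable_def by blast
  have "((\<lambda>s. \<xi> (g s)) has_derivative (\<lambda>h. h *\<^sub>R \<xi>' (g 0) k)) (at 0)"
    by (rule dg) (use e in simp)
  from diff_chain_at[OF this, of l l']
  have "((\<lambda>s. l (\<xi> (g s))) has_derivative (\<lambda>h. 0)) (at 0)"
    using l' u0 k0 has_derivative_linear[OF l'] by (simp add: o_def g0 linear_0)
  then have "(g has_derivative (\<lambda>h. 0)) (at 0)"
    by (rule has_derivative_transform_within_open[where s = "{-e<..<e}"]) (use e l in auto)
  moreover have "(g has_derivative (\<lambda>h. h *\<^sub>R k)) (at 0)"
    unfolding g_def by (auto intro!: derivative_eq_intros)
  ultimately have "(\<lambda>h::real. 0) = (\<lambda>h. h *\<^sub>R k)" by (rule has_derivative_unique)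
  from fun_cong[OF this, of 1] show ?thesis by simp
qed

text \<open>The parameter \<open>u = l (p y)\<close> of the maximiser is a critical point of \<open>y \<bullet> \<xi>\<close> on \<open>T\<close>. These equations
  are completed to a map \<open>G\<close> into the whole space by the projection onto the orthogonal complement of
  \<open>T\<close>, so that \<open>G (y, u) = 0\<close> says that \<open>u\<close> is critical and lies in \<open>T\<close>. Its derivative in \<open>u\<close> is
  injective by nondegeneracy, and inverting \<open>(y, u) \<mapsto> (y, G (y, u))\<close> makes \<open>u\<close> a \<open>C\<^sup>1\<close> function
  of \<open>y\<close>.\<close>
lemma C1_on_p_near:
  assumes y0: "y0 \<in> D" and par: "C2_parametrized_at X (p y0)"
  shows "\<exists>U. open U \<and> y0 \<in> U \<and> C1_on p U"
proof -
  obtain W T and \<xi> l :: "'a \<Rightarrow> 'a" and A where W: "open W" and T: "subspace T" and C2: "C2_on \<xi> W" and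
    X: "\<xi> ` (W \<inter> T) \<subseteq> X" and l: "\<And>w. w \<in> W \<inter> T \<Longrightarrow> l (\<xi> w) = w" and A: "open A" "p y0 \<in> A" and
    dl: "l differentiable (at (p y0))" and
    AX: "\<And>x. x \<in> A \<inter> X \<Longrightarrow> l x \<in> W \<inter> T \<and> \<xi> (l x) = x"
    using par unfolding C2_parametrized_at_def by blast
  obtain \<xi>' \<xi>'' where d1: "\<And>w. w \<in> W \<Longrightarrow> (\<xi> has_derivative blinfun_apply (\<xi>' w)) (at w)"
    and d2: "\<And>w. w \<in> W \<Longrightarrow> (\<xi>' has_derivative blinfun_apply (\<xi>'' w)) (at w)" and cont: "continuous_on W \<xi>''"
    using C2 unfolding C2_on_def by blast
  define u0 where "u0 = l (p y0)"
  have u0: "u0 \<in> W \<inter> T" "\<xi> u0 = p y0" using AX[of "p y0"] A p_mem[OF y0] by (auto simp: u0_def)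
  obtain B where B: "B \<subseteq> T" "pairwise orthogonal B" "\<And>b. b \<in> B \<Longrightarrow> norm b = 1"
      "independent B" "span B = T"
    using orthonormal_basis_subspace[OF T] by metis
  have finB: "finite B" using B(4) by (rule independent_imp_finite)
  have expand: "(\<Sum>b\<in>B. (w \<bullet> b) *\<^sub>R b) = w" if "w \<in> T" for w
    by (rule sum_orthonormal_basis) (use B finB that in auto)
  define G where "G z = (\<Sum>b\<in>B. (fst z \<bullet> \<xi>' (snd z) b - snd z \<bullet> b) *\<^sub>R b) + snd z" for z
  define F where "F z = (fst z, G z)" for z
  have C1\<xi>': "C1_on \<xi>' W" using d2 cont by (rule C1_onI)
  have C1_snd: "C1_on snd S" and C1_fst: "C1_on fst S" for S :: "('a \<times> 'a) set"
    by (auto intro: C1_on_bounded_linear bounded_linear_fst bounded_linear_snd)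
  have "C1_on F (UNIV \<times> W)"
    unfolding F_def G_def
    by (intro C1_on_Pair C1_on_add C1_on_sum C1_on_bilinear[OF bounded_bilinear_scaleR] C1_on_diff C1_on_const
        C1_on_bilinear[OF bounded_bilinear_inner] C1_snd C1_fst
        C1_on_linear_image[OF blinfun.bounded_linear_left] C1_on_compose[OF C1_snd C1\<xi>']) auto
  then obtain F' where F': "\<And>z. z \<in> UNIV \<times> W \<Longrightarrow> (F has_derivative blinfun_apply (F' z)) (at z)"
    "continuous_on (UNIV \<times> W) F'" unfolding C1_on_def by blast
  have F'0: "F' (y0, u0) hk =
     (fst hk, (\<Sum>b\<in>B. (fst hk \<bullet> \<xi>' u0 b + y0 \<bullet> \<xi>'' u0 (snd hk) b - snd hk \<bullet> b) *\<^sub>R b) + snd hk)" for hk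
  proof -
    have 1: "((\<lambda>z. \<xi>' (snd z)) has_derivative (\<lambda>hk. \<xi>'' u0 (snd hk))) (at (y0, u0))"
      using diff_chain_at[of snd snd "(y0, u0)" \<xi>' "\<xi>'' u0"] d2[of u0] u0
      by (auto simp: o_def has_derivative_snd intro!: derivative_intros)
    have "(F has_derivative (\<lambda>hk. (fst hk, (\<Sum>b\<in>B. (fst hk \<bullet> \<xi>' u0 b + y0 \<bullet> \<xi>'' u0 (snd hk) b - snd hk \<bullet> b) *\<^sub>R b)
        + snd hk))) (at (y0, u0))"
      unfolding F_def G_def
      by (rule has_derivative_eq_rhs)
        (rule derivative_intros 1 bounded_linear.has_derivative[OF blinfun.bounded_linear_left 1] | 
          (auto simp: blinfun.bilinear_simps add.commute)[1])+
    from has_derivative_unique[OF F'(1) this] u0 show ?thesis by auto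
  qed
  have inj: "inj (blinfun_apply (F' (y0, u0)))"
  proof -
    have "hk = 0" if hk: "F' (y0, u0) hk = 0" for hk
    proof -
      define k where "k = snd hk"
      have h: "fst hk = 0" using arg_cong[OF hk[unfolded F'0], of fst] by simp
      have "(\<Sum>b\<in>B. (y0 \<bullet> \<xi>'' u0 k b - k \<bullet> b) *\<^sub>R b) + k = 0"
        using arg_cong[OF hk[unfolded F'0], of snd] h by (simp add: k_def)
      then have k: "k = (\<Sum>b\<in>B. (k \<bullet> b - y0 \<bullet> \<xi>'' u0 k b) *\<^sub>R b)"
        by (simp add: scaleR_left_diff_distrib sum_subtractf eq_neg_iff_add_eq_0 algebra_simps)
      have kT: "k \<in> T"
        by (subst k) (use B(1) T in \<open>auto intro!: subspace_sum subspace_scale\<close>)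
      have "(\<Sum>b\<in>B. (y0 \<bullet> \<xi>'' u0 k b) *\<^sub>R b) = 0"
        using k expand[OF kT] by (simp add: scaleR_left_diff_distrib sum_subtractf)
      then have "0 = k \<bullet> (\<Sum>b\<in>B. (y0 \<bullet> \<xi>'' u0 k b) *\<^sub>R b)" by simp
      also have "\<dots> = y0 \<bullet> \<xi>'' u0 k (\<Sum>b\<in>B. (k \<bullet> b) *\<^sub>R b)"
        by (simp add: inner_sum_right blinfun.sum_right blinfun.scaleR_right mult.commute)
      finally have "y0 \<bullet> \<xi>'' u0 k k = 0" using expand[OF kT] by simp
      then have "k = 0"
        using critical_nondegenerate[OF y0 refl W T d1 d2 X l dl u0 kT] by blast
      then show "hk = 0" using h by (simp add: k_def prod_eq_iff)
    qed
    then show ?thesis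
      by (simp add: linear_injective_0 bounded_linear.linear blinfun.bounded_linear_right)
  qed
  obtain U' V g where U': "open U'" "U' \<subseteq> UNIV \<times> W" "(y0, u0) \<in> U'" and V: "open V" "F (y0, u0) \<in> V"
    and hom: "homeomorphism U' V F g" and gC1: "C1_on g V"
    by (rule local_C1_inverse[OF _ F' _ inj]) (use W u0 in \<open>auto intro: open_Times\<close>)
  have F0: "F (y, l (p y)) = (y, 0)" if y: "y \<in> D" "p y \<in> A" for y
  proof -
    define u where "u = l (p y)"
    have u: "u \<in> W \<inter> T" "\<xi> u = p y" using AX[of "p y"] y p_mem by (auto simp: u_def)
    have "y \<bullet> \<xi>' u b = 0" if b: "b \<in> B" for b
    proof -
      have bT: "b \<in> T" using b B(1) by blast
      have "open ((\<lambda>s. u + s *\<^sub>R b) -` W)" by (intro open_vimage W continuous_intros)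
      moreover have "(0::real) \<in> (\<lambda>s. u + s *\<^sub>R b) -` W" using u by simp
      ultimately obtain e where e: "e > 0" "ball (0::real) e \<subseteq> (\<lambda>s. u + s *\<^sub>R b) -` W"
        using open_contains_ball by blast
      have d: "((\<lambda>s. \<xi> (u + s *\<^sub>R b)) has_derivative (\<lambda>h. h *\<^sub>R \<xi>' u b)) (at 0)"
        by (rule line_deriv) (use d1 u in auto)
      have "((\<lambda>s. y \<bullet> \<xi> (u + s *\<^sub>R b)) has_real_derivative y \<bullet> \<xi>' u b) (at 0)"
        using bounded_linear.has_derivative[OF bounded_linear_inner_right d, of y]
        by (simp add: has_field_derivative_def mult_commute_abs)
      then show ?thesis
      proof (rule DERIV_local_max[OF _ e(1)], intro allI impI)
        fix s :: real assume "\<bar>0 - s\<bar> < e"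
        then have "u + s *\<^sub>R b \<in> W \<inter> T"
          using e u bT T by (auto simp: subset_iff dist_norm intro: subspace_add subspace_scale)
        then have "y \<bullet> \<xi> (u + s *\<^sub>R b) \<le> y \<bullet> p y" using X by (intro p_ge y) auto
        then show "y \<bullet> \<xi> (u + s *\<^sub>R b) \<le> y \<bullet> \<xi> (u + 0 *\<^sub>R b)" using u by simp
      qed
    qed
    then have "G (y, u) = - (\<Sum>b\<in>B. (u \<bullet> b) *\<^sub>R b) + u"
      by (simp add: G_def sum_negf)
    then show ?thesis using expand u by (simp add: F_def u_def[symmetric])
  qed
  have cont_l: "isCont (\<lambda>y. (y, l (p y))) y0"
    using isCont_p[OF y0] differentiable_imp_continuous_within[OF dl]
    by (intro continuous_intros isCont_o2[OF isCont_p[OF y0]]) auto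
  have "\<forall>\<^sub>F y in nhds y0. y \<in> D \<and> p y \<in> A \<and> (y, l (p y)) \<in> U'"
  proof (intro eventually_conj)
    show "\<forall>\<^sub>F y in nhds y0. y \<in> D" using open_D y0 by (rule eventually_nhds_in_open)
    show "\<forall>\<^sub>F y in nhds y0. p y \<in> A"
      by (rule topological_tendstoD[OF isCont_p[OF y0, unfolded isCont_def tendsto_at_iff_tendsto_nhds] A])
    show "\<forall>\<^sub>F y in nhds y0. (y, l (p y)) \<in> U'"
      using topological_tendstoD[OF cont_l[unfolded isCont_def tendsto_at_iff_tendsto_nhds] U'(1)] U'(3)
      by (simp add: u0_def eventually_nhds_conv_at)
  qed
  then obtain U where U: "open U" "y0 \<in> U" "\<And>y. y \<in> U \<Longrightarrow> y \<in> D \<and> p y \<in> A \<and> (y, l (p y)) \<in> U'"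
    unfolding eventually_nhds by blast
  have inV: "(y, 0) \<in> V" and geq: "g (y, 0) = (y, l (p y))" if "y \<in> U" for y
  proof -
    have y: "F (y, l (p y)) = (y, 0)" "(y, l (p y)) \<in> U'" using U(3)[OF that] F0 by auto
    show "(y, 0) \<in> V"
      using imageI[OF y(2), of F] unfolding homeomorphism_image1[OF hom] y(1) .
    show "g (y, 0) = (y, l (p y))"
      using homeomorphism_apply1[OF hom y(2)] unfolding y(1) .
  qed
  have "C1_on (\<lambda>y. \<xi> (snd (g (y, 0)))) U"
  proof (rule C1_on_compose[where g = \<xi> and T = W])
    have "C1_on (\<lambda>y. (y, 0)) U"
      by (intro C1_on_Pair C1_on_const C1_on_bounded_linear bounded_linear_ident)
    then have "C1_on (\<lambda>y. g (y, 0)) U"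
      by (rule C1_on_compose[OF _ gC1]) (use inV in auto)
    then show "C1_on (\<lambda>y. snd (g (y, 0))) U"
      by (rule C1_on_linear_image[OF bounded_linear_snd])
    show "C1_on \<xi> W" by (rule C2_on_imp_C1_on[OF C2])
    show "(\<lambda>y. snd (g (y, 0))) ` U \<subseteq> W" using geq U(3) AX p_mem by auto
  qed
  then have "C1_on p U"
    by (rule C1_on_cong_open[OF _ U(1)]) (use geq U(3) AX p_mem in auto)
  with U show ?thesis by blast
qed

lemma C2_on_max_value_of_parametrized:
  assumes "\<And>y. y \<in> D \<Longrightarrow> C2_parametrized_at X (p y)"
  shows "C2_on (\<lambda>y. y \<bullet> p y) D"
  by (intro C2_on_max_value C1_on_local C1_on_p_near assms)

end

section \<open>Smoothness of the distance function on projective space\<close>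

lemma Line_scaleR: "c \<noteq> 0 \<Longrightarrow> Line (c *\<^sub>R y) = Line y"
  unfolding Line_def by (subst span_image_scale[of "{y}" "\<lambda>_. c", symmetric]) auto

lemma Line_normalize: "y \<noteq> 0 \<Longrightarrow> Line (y /\<^sub>R norm y) = Line y"
  by (simp add: Line_scaleR)

lemma Line_eq_unit:
  assumes "norm x = 1" "norm y = 1" "Line x = Line y"
  shows "x = y \<or> x = - y"
proof -
  have nz: "x \<noteq> 0" "y \<noteq> 0" using assms by auto
  have "x \<in> points_of (Line y)"
    using points_of_Line[OF nz(1)] assms(3) by (simp add: span_base)
  then obtain c where c: "x = c *\<^sub>R y" using points_of_Line[OF nz(2)] by (auto simp: span_singleton)
  then have "\<bar>c\<bar> = 1" using assms by simp
  then show ?thesis using c by (auto simp: abs_if split: if_splits)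
qed

lemma dP_Line:
  assumes y: "y \<noteq> 0" and x: "norm x = 1"
  shows "dP (Line y) (Line x) = sqrt (1 - (y \<bullet> x)\<^sup>2 / (y \<bullet> y))"
proof -
  have n: "norm (y /\<^sub>R norm y) = 1" using y by simp
  have "\<bar>(y /\<^sub>R norm y) \<bullet> x\<bar> \<le> 1" using Cauchy_Schwarz_ineq2[of "y /\<^sub>R norm y" x] n x by simp
  then have "dP (Line (y /\<^sub>R norm y)) (Line x) = sqrt (1 - \<bar>(y /\<^sub>R norm y) \<bullet> x\<bar>\<^sup>2)"
    unfolding dP_def dR_Line[OF n x] by (intro sin_arccos) auto
  also have "\<bar>(y /\<^sub>R norm y) \<bullet> x\<bar>\<^sup>2 = (y \<bullet> x)\<^sup>2 / (y \<bullet> y)"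
    by (simp add: power_mult_distrib power2_norm_eq_inner[symmetric] divide_inverse mult.commute power_inverse)
  finally show ?thesis by (simp add: Line_normalize[OF y])
qed

lemma dP_le_iff:
  assumes "y \<noteq> 0" "norm x = 1" "norm x' = 1"
  shows "dP (Line y) (Line x) \<le> dP (Line y) (Line x') \<longleftrightarrow> (y \<bullet> x')\<^sup>2 \<le> (y \<bullet> x)\<^sup>2"
proof -
  define c where "c = y \<bullet> y"
  have "c > 0" using assms by (simp add: c_def)
  then show ?thesis
    by (simp add: dP_Line[OF assms(1)] assms c_def[symmetric] divide_le_cancel)
qed

definition unit_lifts :: "'n::finite proj set \<Rightarrow> (real ^ 'n) set" where
  "unit_lifts N = {x. norm x = 1 \<and> Line x \<in> N}"

lemma unit_lifts_minus: "x \<in> unit_lifts N \<Longrightarrow> - x \<in> unit_lifts N"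
  using Line_scaleR[of "-1" x] by (simp add: unit_lifts_def)

lemma closest_point_dP_Line:
  assumes "y \<noteq> 0" "norm x = 1"
  shows "closest_point_dP N (Line y) (Line x) \<longleftrightarrow>
    x \<in> unit_lifts N \<and> (\<forall>x'\<in>unit_lifts N. (y \<bullet> x')\<^sup>2 \<le> (y \<bullet> x)\<^sup>2)"
proof -
  have "(\<forall>M\<in>N. P M) \<longleftrightarrow> (\<forall>x\<in>unit_lifts N. P (Line x))" for P
    unfolding unit_lifts_def using Line_surj by (metis (mono_tags, lifting) mem_Collect_eq)
  then show ?thesis
    unfolding closest_point_dP_def using dP_le_iff[OF assms] assms by (auto simp: unit_lifts_def)
qed

text \<open>The sign is such that the vector makes an acute or right angle with \<open>y\<close>; so it maximises the
  inner product itself, which is linear, and not only its square.\<close>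
definition nearest_lift :: "'n::finite proj set \<Rightarrow> real ^ 'n \<Rightarrow> real ^ 'n" where
  "nearest_lift N y = (SOME x. x \<in> unit_lifts N \<and> (\<forall>x'\<in>unit_lifts N. y \<bullet> x' \<le> y \<bullet> x))"

definition cone_over :: "'n::finite proj set \<Rightarrow> (real ^ 'n) set" where
  "cone_over S = {y. y \<noteq> 0 \<and> Line y \<in> S}"

lemma abs_inner_le_max:
  assumes "\<And>x'. x' \<in> unit_lifts N \<Longrightarrow> y \<bullet> x' \<le> y \<bullet> x" "x' \<in> unit_lifts N"
  shows "\<bar>y \<bullet> x'\<bar> \<le> y \<bullet> x"
  using assms(1)[OF assms(2)] assms(1)[OF unit_lifts_minus[OF assms(2)]] by auto

text \<open>Both unit vectors on a line belong to \<open>unit_lifts N\<close>, so comparing absolute values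
  of inner products, as the distance does, amounts to comparing the inner products themselves.\<close>
lemma max_iff_closest:
  assumes "y \<noteq> 0" "x \<in> unit_lifts N" "y \<bullet> x \<ge> 0"
  shows "closest_point_dP N (Line y) (Line x) \<longleftrightarrow> (\<forall>x'\<in>unit_lifts N. y \<bullet> x' \<le> y \<bullet> x)"
proof -
  have "norm x = 1" using assms by (simp add: unit_lifts_def)
  from closest_point_dP_Line[OF assms(1) this, of N] show ?thesis
    using assms abs_inner_le_max[of N y x]
    by (auto simp: abs_le_square_iff[symmetric] abs_le_iff) 
qed

lemma nearest_lift:
  assumes "y \<in> cone_over (unique_closest_domain N)"
  shows "nearest_lift N y \<in> unit_lifts N"
    "x' \<in> unit_lifts N \<Longrightarrow> \<bar>y \<bullet> x'\<bar> \<le> y \<bullet> nearest_lift N y"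
    "closest_point_dP N (Line y) (Line (nearest_lift N y))"
proof -
  have y: "y \<noteq> 0" "Line y \<in> unique_closest_domain N" using assms by (auto simp: cone_over_def)
  obtain M where M: "closest_point_dP N (Line y) M"
    using unique_closest_domain_largest(2)[OF y(2)] by blast
  obtain x where x: "norm x = 1" "M = Line x" by (rule Line_surj)
  have xN: "x \<in> unit_lifts N" using M x closest_point_dP_Line[OF y(1) x(1)] by simp
  have "\<exists>x. x \<in> unit_lifts N \<and> (\<forall>x'\<in>unit_lifts N. y \<bullet> x' \<le> y \<bullet> x)"
  proof (cases "y \<bullet> x \<ge> 0")
    case True then show ?thesis using max_iff_closest[OF y(1) xN] M x(2) xN by blast
  next
    case False
    have "Line (- x) = M" using Line_scaleR[of "-1" x] x by simp
    then show ?thesis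
      using max_iff_closest[OF y(1) unit_lifts_minus[OF xN]] M False unit_lifts_minus[OF xN]
      by (intro exI[of _ "-x"]) auto
  qed
  from someI_ex[OF this] have p: "nearest_lift N y \<in> unit_lifts N"
    "\<And>x'. x' \<in> unit_lifts N \<Longrightarrow> y \<bullet> x' \<le> y \<bullet> nearest_lift N y"
    unfolding nearest_lift_def by blast+
  show "nearest_lift N y \<in> unit_lifts N" by (rule p)
  show abs: "\<bar>y \<bullet> x'\<bar> \<le> y \<bullet> nearest_lift N y" if "x' \<in> unit_lifts N" for x'
    using abs_inner_le_max[OF p(2) that] .
  have "y \<bullet> nearest_lift N y \<ge> 0" using abs[OF p(1)] by linarith
  then show "closest_point_dP N (Line y) (Line (nearest_lift N y))"
    using max_iff_closest[OF y(1) p(1)] p(2) by blast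
qed

lemma dP_set_Line:
  assumes "y \<noteq> 0" "norm x = 1" "closest_point_dP N (Line y) (Line x)"
  shows "dP_set (Line y) N powi (-2) = (y \<bullet> y) / (y \<bullet> y - (y \<bullet> x)\<^sup>2)"
proof -
  have "dP_set (Line y) N = dP (Line y) (Line x)"
    unfolding dP_set_def
    by (rule cInf_eq_minimum) (use assms(3) in \<open>auto simp: closest_point_dP_def\<close>)
  also have "\<dots> = sqrt (1 - (y \<bullet> x)\<^sup>2 / (y \<bullet> y))" by (rule dP_Line[OF assms(1,2)])
  finally have d: "dP_set (Line y) N = sqrt (1 - (y \<bullet> x)\<^sup>2 / (y \<bullet> y))" .
  have pos: "y \<bullet> y > 0" using assms by simp
  have "(y \<bullet> x)\<^sup>2 \<le> (y \<bullet> y) * (x \<bullet> x)" by (rule Cauchy_Schwarz_ineq)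
  also have "x \<bullet> x = 1" using assms(2) by (simp add: norm_eq_1)
  finally have "0 \<le> 1 - (y \<bullet> x)\<^sup>2 / (y \<bullet> y)" using pos by simp
  then have "dP_set (Line y) N powi (-2) = inverse (1 - (y \<bullet> x)\<^sup>2 / (y \<bullet> y))"
    unfolding d by (simp add: power_int_minus)
  also have "1 - (y \<bullet> x)\<^sup>2 / (y \<bullet> y) = (y \<bullet> y - (y \<bullet> x)\<^sup>2) / (y \<bullet> y)"
    using pos by (simp add: diff_divide_distrib)
  finally show ?thesis by simp
qed

lemma coords_chart:
  assumes "L \<in> chart_domain i"
  shows "Line (coords i L) = L" "coords i L $ i = 1"
proof -
  obtain x where x: "norm x = 1" "L = Line x" by (rule Line_surj)
  then have "x \<noteq> 0" by auto
  obtain y where "y \<in> points_of L" "y $ i = 1" using assms unfolding chart_domain_def by blast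
  then have xi: "x $ i \<noteq> 0"
    using x \<open>x \<noteq> 0\<close> by (auto simp: points_of_Line span_singleton)
  show "Line (coords i L) = L" "coords i L $ i = 1"
    using xi unfolding x(2) coords_Line(2)[OF xi] by (auto simp: Line_scaleR)
qed

lemma coords_Line_eq: "y $ i = 1 \<Longrightarrow> coords i (Line y) = y"
  using coords_Line(2)[of y i] by simp

lemma coords_image: "coords i ` (N \<inter> chart_domain i) = {s. s $ i = 1 \<and> Line s \<in> N}"
proof (intro set_eqI iffI)
  fix s assume "s \<in> {s. s $ i = 1 \<and> Line s \<in> N}"
  then show "s \<in> coords i ` (N \<inter> chart_domain i)"
    using coords_Line(1)[of s i] coords_Line_eq[of s i] by (intro image_eqI[of _ _ "Line s"]) auto
qed (auto simp: coords_chart)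

lemma C2_on_normalize:
  fixes f :: "'a::real_normed_vector \<Rightarrow> 'b::real_inner"
  assumes "C2_on f W" "\<And>w. w \<in> W \<Longrightarrow> f w \<noteq> 0"
  shows "C2_on (\<lambda>w. inverse (norm (f w)) *\<^sub>R f w) W"
proof -
  have "C2_on (\<lambda>w. f w \<bullet> f w) W" by (rule C2_on_bilinear[OF bounded_bilinear_inner assms(1,1)])
  then have "C2_on (\<lambda>w. sqrt (f w \<bullet> f w)) W"
    by (rule C2_on_compose[OF _ C2_on_sqrt]) (use assms(2) in auto)
  then have "C2_on (\<lambda>w. inverse (sqrt (f w \<bullet> f w))) W"
    by (rule C2_on_compose[OF _ C2_on_inverse_real]) (use assms(2) in auto)
  then show ?thesis
    unfolding norm_eq_sqrt_inner by (rule C2_on_bilinear[OF bounded_bilinear_scaleR _ assms(1)])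
qed

text \<open>A flattening diffeomorphism \<open>h\<close> of the affine chart gives the parametrization
  \<open>\<plusminus> h\<^sup>-\<^sup>1 / \<parallel>h\<^sup>-\<^sup>1\<parallel>\<close> of the unit lifts; the sign \<open>\<sigma>\<close> is chosen to hit \<open>x0\<close> and not \<open>- x0\<close>. It is
  inverted by projecting back to the hyperplane \<open>{y. y $ i = 1}\<close> and applying \<open>h\<close>.\<close>
lemma submanifold_parametrized:
  fixes N :: "'n::finite proj set"
  assumes N: "C2_submanifold d N" and x0: "x0 \<in> unit_lifts N"
  shows "C2_parametrized_at (unit_lifts N) x0"
proof -
  have "x0 \<noteq> 0" using x0 by (auto simp: unit_lifts_def)
  then obtain i where i: "x0 $ i \<noteq> 0" by (auto simp: vec_eq_iff)
  define \<sigma> where "\<sigma> = sgn (x0 $ i)"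
  have \<sigma>: "\<sigma> * \<sigma> = 1" "\<sigma> \<noteq> 0" "\<bar>\<sigma>\<bar> = 1" using i by (auto simp: \<sigma>_def sgn_if)
  define S where "S = {s :: real ^ 'n. s $ i = 1 \<and> Line s \<in> N}"
  define c where "c x = x /\<^sub>R (x $ i)" for x :: "real ^ 'n"
  have cS: "c x \<in> S" if "x \<in> unit_lifts N" "x $ i \<noteq> 0" for x
    using that by (auto simp: c_def S_def unit_lifts_def Line_scaleR)
  have "C2_submanifold_euclidean d S"
    using N unfolding C2_submanifold_def coords_image S_def by blast
  then obtain V W and h h' :: "real ^ 'n \<Rightarrow> real ^ 'n" and T where
    V: "open V" "c x0 \<in> V" and W: "open W" and hom: "homeomorphism V W h h'" and
    C2: "C2_on h V" "C2_on h' W" and T: "subspace T" and hS: "h ` (V \<inter> S) = W \<inter> T"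
    using cS[OF x0 i] unfolding C2_submanifold_euclidean_def by meson
  \<comment> \<open>away from the subspace \<open>T\<close> the chart inverse may vanish, where normalization is not smooth\<close>
  define W0 where "W0 = W \<inter> h' -` (- {0})"
  have W0: "open W0"
    unfolding W0_def using hom W
    by (intro continuous_open_preimage) (auto simp: homeomorphism_def)
  define \<xi> where "\<xi> w = \<sigma> *\<^sub>R (inverse (norm (h' w)) *\<^sub>R h' w)" for w
  define l where "l x = h (c x)" for x
  define P where "P = {x :: real ^ 'n. 0 < \<sigma> * x $ i}"
  have P: "open P" unfolding P_def by (intro open_Collect_less continuous_intros)
  define A where "A = P \<inter> c -` V"
  have "continuous_on P c"
    unfolding c_def P_def by (intro continuous_intros) auto
  then have A: "open A" unfolding A_def using P V(1) by (intro continuous_open_preimage)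
  have "0 < \<sigma> * x0 $ i" using i by (simp add: \<sigma>_def sgn_if)
  then have x0A: "x0 \<in> A" using V by (simp add: A_def P_def)
  have C2\<xi>: "C2_on \<xi> W0"
  proof -
    have "C2_on (\<lambda>w. inverse (norm (h' w)) *\<^sub>R h' w) W0"
      by (rule C2_on_normalize[OF C2_on_subset[OF C2(2)]]) (auto simp: W0_def)
    then show ?thesis unfolding \<xi>_def
      by (rule C2_on_compose[OF _ C2_on_bounded_linear[OF bounded_linear_scaleR_right, of _ UNIV]]) auto
  qed
  have s: "h' w \<in> V" "h' w \<in> S" "h (h' w) = w" if "w \<in> W0 \<inter> T" for w
  proof -
    have w: "w \<in> W" "w \<in> h ` (V \<inter> S)" using that hS by (auto simp: W0_def)
    then obtain s where s: "s \<in> V" "s \<in> S" "w = h s" by blast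
    then have "h' w = s" using homeomorphism_apply1[OF hom] by simp
    then show "h' w \<in> V" "h' w \<in> S" "h (h' w) = w" using s by auto
  qed
  have "\<xi> ` (W0 \<inter> T) \<subseteq> unit_lifts N"
  proof safe
    fix w assume w: "w \<in> W0" "w \<in> T"
    then have nz: "h' w \<noteq> 0" by (simp add: W0_def)
    then have "norm (\<xi> w) = 1" by (simp add: \<xi>_def \<sigma> abs_mult)
    moreover have "Line (\<xi> w) = Line (h' w)" using nz \<sigma> by (simp add: \<xi>_def Line_scaleR)
    ultimately show "\<xi> w \<in> unit_lifts N" using s(2)[of w] w by (simp add: unit_lifts_def S_def)
  qed
  moreover have "l (\<xi> w) = w" if w: "w \<in> W0 \<inter> T" for w
  proof -
    have "h' w \<noteq> 0" "h' w $ i = 1" using w s(2)[OF w] by (auto simp: W0_def S_def)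
    moreover have "inverse \<sigma> * norm (h' w) * (\<sigma> * inverse (norm (h' w))) = 1"
      using \<sigma>(2) \<open>h' w \<noteq> 0\<close> by (simp add: field_simps)
    ultimately have "c (\<xi> w) = h' w" by (simp add: c_def \<xi>_def)
    then show ?thesis using s(3)[OF w] by (simp add: l_def)
  qed
  moreover have "l differentiable (at x0)"
  proof -
    have "h differentiable (at (c x0))"
      using C2(1) V(2) unfolding C2_on_def differentiable_def by blast
    moreover have "c differentiable (at x0)"
      unfolding c_def using i by (intro derivative_intros) (auto intro!: bounded_linear_imp_differentiable bounded_linear_vec_nth)
    ultimately show ?thesis
      unfolding l_def using differentiable_chain_at[of c x0 h] by (simp add: o_def)
  qed
  moreover have "l x \<in> W0 \<inter> T \<and> \<xi> (l x) = x" if x: "x \<in> A \<inter> unit_lifts N" for x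
  proof -
    have pos: "0 < \<sigma> * x $ i" using x by (auto simp: A_def P_def)
    then have xi: "x $ i \<noteq> 0" by auto
    have nx: "norm x = 1" using x by (auto simp: unit_lifts_def)
    have cx: "c x \<in> V \<inter> S" using x cS[of x] xi by (auto simp: A_def)
    then have h'l: "h' (l x) = c x" using homeomorphism_apply1[OF hom] by (simp add: l_def)
    have "l x \<in> W \<inter> T" using cx hS by (auto simp: l_def)
    moreover have "c x \<noteq> 0" using cx by (auto simp: S_def)
    ultimately have "l x \<in> W0 \<inter> T" using h'l by (simp add: W0_def)
    moreover have "\<xi> (l x) = (\<sigma> * \<bar>x $ i\<bar> / x $ i) *\<^sub>R x"
      using xi nx by (simp add: \<xi>_def h'l c_def divide_inverse mult.assoc)
    moreover have "\<sigma> * \<bar>x $ i\<bar> / x $ i = 1"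
      using pos xi by (auto simp: \<sigma>_def sgn_if abs_if zero_less_mult_iff split: if_splits)
    ultimately show ?thesis by simp
  qed
  ultimately show ?thesis
    unfolding C2_parametrized_at_def using W0 T C2\<xi> A x0A by blast
qed

lemma open_cone_over: "open S \<longleftrightarrow> open (cone_over S)"
  by (simp add: cone_over_def open_proj_def)

text \<open>The squared maximum is \<open>C\<^sup>2\<close> even where the maximum vanishes. There the maximiser is determined
  only up to sign, but then all points of \<open>N\<close> are equally far, so uniqueness leaves a single line
  and the square is a quadratic form. If the maximum never vanishes, the sign of the maximiser is
  determined and the results on unique maximisers apply.\<close>
lemma C2_on_max_square:
  fixes N :: "'n::finite proj set"
  assumes N: "C2_submanifold d N"
  shows "C2_on (\<lambda>y. (y \<bullet> nearest_lift N y)\<^sup>2) (cone_over (unique_closest_domain N))"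
proof -
  define D where "D = cone_over (unique_closest_domain N)"
  define p where "p = nearest_lift N"
  have D: "open D"
    unfolding D_def open_cone_over[symmetric] by (rule unique_closest_domain_largest)
  have p: "p y \<in> unit_lifts N" "closest_point_dP N (Line y) (Line (p y))"
    "\<And>x. x \<in> unit_lifts N \<Longrightarrow> \<bar>y \<bullet> x\<bar> \<le> y \<bullet> p y" if "y \<in> D" for y
    using nearest_lift[of y N] that by (auto simp: D_def p_def)
  have uniq: "x = p y \<or> x = - p y" if y: "y \<in> D" and x: "x \<in> unit_lifts N" "\<bar>y \<bullet> x\<bar> = y \<bullet> p y" for x y
  proof -
    have "y \<noteq> 0" "Line y \<in> unique_closest_domain N" using y by (auto simp: D_def cone_over_def)
    note ex1 = unique_closest_domain_largest(2)[OF this(2)]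
    note \<open>y \<noteq> 0\<close>
    moreover have "norm x = 1" using x by (simp add: unit_lifts_def)
    ultimately have "closest_point_dP N (Line y) (Line x)"
      using x p(3)[OF y] by (auto simp: closest_point_dP_Line abs_le_square_iff[symmetric])
    then have "Line x = Line (p y)" using p(2)[OF y] ex1 by blast
    then show ?thesis using x p(1)[OF y] by (intro Line_eq_unit) (auto simp: unit_lifts_def)
  qed
  have "C2_on (\<lambda>y. (y \<bullet> p y)\<^sup>2) D"
  proof (cases "\<exists>y0\<in>D. y0 \<bullet> p y0 = 0")
    case True
    then obtain y0 where y0: "y0 \<in> D" "y0 \<bullet> p y0 = 0" by blast
    have all: "x = p y0 \<or> x = - p y0" if "x \<in> unit_lifts N" for x
      using uniq[OF y0(1) that] p(3)[OF y0(1) that] y0(2) by simp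
    have sq: "(y \<bullet> p y0) * (y \<bullet> p y0) = (y \<bullet> p y)\<^sup>2" if "y \<in> D" for y
      using all[OF p(1)[OF that]] by (auto simp: power2_eq_square)
    have "C2_on (\<lambda>y. (y \<bullet> p y0) * (y \<bullet> p y0)) D"
      by (intro C2_on_bilinear[OF bounded_bilinear_mult] C2_on_bounded_linear bounded_linear_inner_left)
    then show ?thesis by (rule C2_on_cong_open[OF _ D]) (rule sq)
  next
    case False
    then have pos: "y \<bullet> p y > 0" if "y \<in> D" for y
      using p(3)[OF that p(1)[OF that]] that by force
    interpret unique_maximiser "unit_lifts N" D p
    proof
      fix x y assume y: "y \<in> D" and x: "x \<in> unit_lifts N" "x \<noteq> p y"
      show "y \<bullet> x < y \<bullet> p y"
      proof (rule ccontr)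
        assume "\<not> y \<bullet> x < y \<bullet> p y"
        then have "y \<bullet> x = y \<bullet> p y" "\<bar>y \<bullet> x\<bar> = y \<bullet> p y" using p(3)[OF y x(1)] by auto
        then show False using uniq[OF y x(1)] x(2) pos[OF y] by auto
      qed
    qed (use D p in \<open>auto simp: unit_lifts_def\<close>)
    have "C2_on (\<lambda>y. y \<bullet> p y) D"
      by (rule C2_on_max_value_of_parametrized) (intro submanifold_parametrized[OF N] p)
    from C2_on_bilinear[OF bounded_bilinear_mult this this] show ?thesis
      by (simp add: power2_eq_square)
  qed
  then show ?thesis by (simp add: D_def p_def)
qed

text \<open>The equality case of the Cauchy-Schwarz inequality.\<close>
lemma cone_over_complement:
  "cone_over (unique_closest_domain N - N) =
    {y \<in> cone_over (unique_closest_domain N). 0 < y \<bullet> y - (y \<bullet> nearest_lift N y)\<^sup>2}"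
proof -
  have "Line y \<in> N \<longleftrightarrow> \<not> 0 < y \<bullet> y - (y \<bullet> nearest_lift N y)\<^sup>2"
    if y: "y \<in> cone_over (unique_closest_domain N)" for y
  proof
    define p where "p = nearest_lift N y"
    have y0: "y \<noteq> 0" using y by (simp add: cone_over_def)
    have p: "p \<in> unit_lifts N" "norm p = 1" using nearest_lift(1)[OF y] by (auto simp: p_def unit_lifts_def)
    {
      assume "Line y \<in> N"
      then have "y /\<^sub>R norm y \<in> unit_lifts N" using y0 by (simp add: unit_lifts_def Line_normalize)
      moreover have "y \<bullet> (y /\<^sub>R norm y) = norm y"
        using y0 by (simp add: power2_norm_eq_inner[symmetric] power2_eq_square)
      ultimately have "norm y \<le> y \<bullet> p" using nearest_lift(2)[OF y] by (metis abs_norm_cancel p_def)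
      then have "(norm y)\<^sup>2 \<le> (y \<bullet> p)\<^sup>2" by (intro power_mono) auto
      then show "\<not> 0 < y \<bullet> y - (y \<bullet> nearest_lift N y)\<^sup>2"
        by (simp add: power2_norm_eq_inner p_def)
    }
    assume "\<not> 0 < y \<bullet> y - (y \<bullet> nearest_lift N y)\<^sup>2"
    then have "(norm y)\<^sup>2 \<le> (y \<bullet> p)\<^sup>2" by (simp add: power2_norm_eq_inner p_def)
    moreover have "0 \<le> y \<bullet> p" using nearest_lift(2)[OF y p(1)] by (simp add: p_def)
    ultimately have "norm y \<le> y \<bullet> p" by (rule power2_le_imp_le)
    then have "y \<bullet> p = norm y * norm p" using norm_cauchy_schwarz[of y p] p by simp
    then have "y = norm y *\<^sub>R p" unfolding norm_cauchy_schwarz_eq using p by simp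
    then have "Line y = Line p" using y0 by (metis Line_scaleR norm_eq_zero)
    then show "Line y \<in> N" using p by (simp add: unit_lifts_def)
  qed
  then show ?thesis by (auto simp: cone_over_def)
qed

lemma C2_on_dP_set:
  fixes N :: "'n::finite proj set"
  assumes N: "C2_submanifold d N"
  defines "S \<equiv> unique_closest_domain N - N"
  shows "open S" "C2_on_proj (\<lambda>x. dP_set x N powi (-2)) S"
    "x \<in> S \<Longrightarrow> dP_set x N powi (-2) > 0"
proof -
  define D where "D = cone_over (unique_closest_domain N)"
  define Q where "Q y = y \<bullet> y - (y \<bullet> nearest_lift N y)\<^sup>2" for y
  have D: "open D"
    unfolding D_def open_cone_over[symmetric] by (rule unique_closest_domain_largest)
  have S: "cone_over S = D \<inter> Q -` {0<..}"
    unfolding S_def cone_over_complement by (auto simp: D_def Q_def)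
  have C2Q: "C2_on Q D"
    unfolding Q_def D_def
    by (intro C2_on_diff C2_on_max_square[OF N] C2_on_bilinear[OF bounded_bilinear_inner] C2_on_id)
  have oS: "open (cone_over S)"
    unfolding S by (intro continuous_open_preimage C1_on_imp_continuous_on C2_on_imp_C1_on C2Q D) auto
  then show "open S" by (simp add: open_cone_over)
  have val: "dP_set (Line y) N powi (-2) = (y \<bullet> y) * inverse (Q y)" if "y \<in> cone_over S" for y
  proof -
    have y: "y \<in> cone_over (unique_closest_domain N)" using that S by (simp add: D_def)
    have "y \<noteq> 0" using y by (simp add: cone_over_def)
    from dP_set_Line[OF this _ nearest_lift(3)[OF y]] nearest_lift(1)[OF y]
    show ?thesis by (simp add: Q_def divide_inverse unit_lifts_def)
  qed
  have "C2_on (\<lambda>y. inverse (Q y)) (cone_over S)"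
    by (rule C2_on_compose[OF C2_on_subset[OF C2Q] C2_on_inverse_real]) (auto simp: S)
  then have "C2_on (\<lambda>y. (y \<bullet> y) * inverse (Q y)) (cone_over S)"
    by (intro C2_on_bilinear[OF bounded_bilinear_mult] C2_on_bilinear[OF bounded_bilinear_inner] C2_on_id)
  then show "C2_on_proj (\<lambda>x. dP_set x N powi (-2)) S"
    unfolding C2_on_proj_def cone_over_def[symmetric]
    by (rule C2_on_cong_open[OF _ oS]) (simp add: val)
  show "dP_set x N powi (-2) > 0" if "x \<in> S"
  proof -
    obtain y where y: "norm y = 1" "x = Line y" by (rule Line_surj)
    then have "y \<in> cone_over S" using that by (auto simp: cone_over_def)
    then show ?thesis using val S y by (auto simp: norm_eq_1)
  qed
qed

section \<open>Convexity from support functions\<close>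

text \<open>If \<open>g\<close> exceeded a chord somewhere, adding a small convex parabola that vanishes at both ends of the chord
  would leave a positive interior maximum of the difference. The supporting function,
  modified in the same way, has a local maximum there too, although its second derivative is positive.\<close>
lemma convex_on_if_supported:
  fixes g :: "real \<Rightarrow> real"
  assumes I: "is_interval I" and g: "continuous_on I g"
    and supp: "\<And>t. t \<in> interior I \<Longrightarrow> \<exists>f f' c d. d > 0 \<and> 0 \<le> c \<and> f t = g t \<and>
      (\<forall>s. \<bar>s - t\<bar> < d \<longrightarrow> f s \<le> g s \<and> (f has_real_derivative f' s) (at s)) \<and>
      (f' has_real_derivative c) (at t)"
  shows "convex_on I g"
proof (rule convex_on_linorderI)
  show "convex I" using I by (simp add: is_interval_convex_1)
  fix u x y :: real
  assume u: "0 < u" "u < 1" and x: "x \<in> I" and y: "y \<in> I" and xy: "x < y"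
  have sub: "{x..y} \<subseteq> I" using mem_is_interval_1_I[OF I x y] by auto
  define m where "m = (g y - g x) / (y - x)"
  define t1 where "t1 = (1 - u) * x + u * y"
  have t1: "t1 = x + u * (y - x)" by (simp add: t1_def algebra_simps)
  have "0 < u * (y - x)" "u * (y - x) < 1 * (y - x)" using u xy by (auto intro: mult_strict_right_mono)
  then have t1xy: "x < t1" "t1 < y" unfolding t1 by auto
  define h where "h s = g s - (g x + (s - x) * m)" for s
  have "h t1 \<le> 0"
  proof (rule ccontr)
    assume "\<not> h t1 \<le> 0"
    then have pos: "h t1 > 0" by simp
    \<comment> \<open>the parabola subtracts exactly half of the excess at \<open>t1\<close>\<close>
    define w where "w = (t1 - x) * (y - t1)"
    define \<epsilon> where "\<epsilon> = h t1 / (2 * w)"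
    have p0: "w > 0" using t1xy by (simp add: w_def)
    have \<epsilon>: "\<epsilon> > 0" using pos p0 by (simp add: \<epsilon>_def)
    define K where "K s = h s + \<epsilon> * ((s - x) * (s - y))" for s
    have "\<epsilon> * w = h t1 / 2" using p0 by (simp add: \<epsilon>_def)
    moreover have "K t1 = h t1 - \<epsilon> * w" by (simp add: K_def w_def algebra_simps)
    ultimately have Kt1: "K t1 > 0" using pos by simp
    have Kxy: "K x = 0" "K y = 0" using xy by (auto simp: K_def h_def m_def)
    have "continuous_on {x..y} K"
      unfolding K_def h_def by (intro continuous_intros continuous_on_subset[OF g sub])
    then obtain t where t: "t \<in> {x..y}" "\<And>s. s \<in> {x..y} \<Longrightarrow> K s \<le> K t"
      using continuous_attains_sup[of "{x..y}" K] xy by auto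
    have "K t > 0" using t(2)[of t1] t1xy Kt1 by simp
    then have txy: "x < t" "t < y" using t(1) Kxy by (auto simp: less_le)
    have "{x<..<y} \<subseteq> interior I" by (rule interior_maximal) (use sub in auto)
    then have "t \<in> interior I" using txy by auto
    from supp[OF this] obtain f f' c d where d: "d > 0" "0 \<le> c" "f t = g t"
      "\<And>s. \<bar>s - t\<bar> < d \<Longrightarrow> f s \<le> g s" "\<And>s. \<bar>s - t\<bar> < d \<Longrightarrow> (f has_real_derivative f' s) (at s)"
      "(f' has_real_derivative c) (at t)" by blast
    define e where "e = Min {d, t - x, y - t}"
    have e: "e > 0" "e \<le> d" "e \<le> t - x" "e \<le> y - t" using d txy by (auto simp: e_def)
    have "c + 2 * \<epsilon> \<le> 0"
    proof (rule second_deriv_nonpos_at_max[OF e(1)])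
      fix s assume s: "\<bar>s - t\<bar> < e"
      show "((\<lambda>s. f s - (g x + (s - x) * m) + \<epsilon> * ((s - x) * (s - y))) has_real_derivative
          (f' s - m + \<epsilon> * (2 * s - x - y))) (at s)"
        using d(5)[of s] s e by (auto intro!: derivative_eq_intros simp: algebra_simps)
      have "f s - (g x + (s - x) * m) + \<epsilon> * ((s - x) * (s - y)) \<le> K s"
        using d(4)[of s] s e by (simp add: K_def h_def)
      also have "\<dots> \<le> K t" using s e by (intro t) auto
      finally show "f s - (g x + (s - x) * m) + \<epsilon> * ((s - x) * (s - y))
          \<le> f t - (g x + (t - x) * m) + \<epsilon> * ((t - x) * (t - y))"
        by (simp add: K_def h_def d(3))
    next
      show "((\<lambda>s. f' s - m + \<epsilon> * (2 * s - x - y)) has_real_derivative c + 2 * \<epsilon>) (at t)"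
        using d(6) by (auto intro!: derivative_eq_intros)
    qed
    then show False using d(2) \<epsilon> by simp
  qed
  moreover have "g x + (t1 - x) * m = (1 - u) * g x + u * g y"
  proof -
    have "(t1 - x) * m = u * (g y - g x)" using xy by (simp add: t1 m_def)
    then show ?thesis by (simp add: algebra_simps)
  qed
  ultimately show "g ((1 - u) *\<^sub>R x + u *\<^sub>R y) \<le> (1 - u) * g x + u * g y"
    by (simp add: h_def t1_def)
qed

section \<open>The geodesic equation of the conformal metric\<close>

lemma linear_axis_sum:
  fixes f :: "real ^ 'n::finite \<Rightarrow> real"
  assumes "linear f" shows "(\<Sum>k\<in>UNIV. v $ k * f (axis k 1)) = f v"
proof -
  have "f v = f (\<Sum>k\<in>UNIV. v $ k *\<^sub>R axis k 1)"
    using basis_expansion[of v] by (simp add: scalar_mult_eq_scaleR)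
  also have "\<dots> = (\<Sum>k\<in>UNIV. v $ k * f (axis k 1))"
    by (simp add: linear_sum[OF assms] linear_scale[OF assms])
  finally show ?thesis ..
qed

lemma partial_deriv_eq:
  assumes "(F has_derivative F') (at y)"
  shows "partial_deriv k F y = F' (axis k 1)"
proof -
  have "((\<lambda>s. F (y + s *\<^sub>R axis k 1)) has_vector_derivative F' (axis k 1)) (at 0)"
    unfolding has_vector_derivative_def by (rule line_deriv) (use assms in simp)
  then show ?thesis unfolding partial_deriv_def by (rule vector_derivative_at)
qed

text \<open>Contracting the Christoffel symbols with the velocity: for fixed \<open>v\<close>, the sum of
  \<open>[kl, m] v\<^sub>k v\<^sub>l\<close> is the derivative along \<open>v\<close> of \<open>g(e\<^sub>m, v)\<close> minus half the \<open>m\<close>-th partial derivative of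
  \<open>g(v, v)\<close>. As \<open>v\<close> and \<open>a\<close> have no \<open>i\<close>-th component, the sums may run over all indices, which makes
  them inner products.\<close>
lemma geodesic_equation_contracted:
  fixes g :: "'n \<Rightarrow> 'n \<Rightarrow> real ^ 'n::finite \<Rightarrow> real"
  assumes geo: "geodesic_equation g (- {i}) y v a" and vi: "v $ i = 0" and ai: "a $ i = 0"
    and sym: "\<And>k l. g k l = g l k"
    and dg: "\<And>k l. (g k l has_derivative g' k l) (at y)"
    and A: "((\<lambda>z. \<Sum>l\<in>UNIV. g m l z * v $ l) has_derivative A') (at y)"
    and B: "((\<lambda>z. \<Sum>k\<in>UNIV. \<Sum>l\<in>UNIV. g k l z * v $ k * v $ l) has_derivative B') (at y)"
    and m: "m \<noteq> i"
  shows "(\<Sum>l\<in>UNIV. g m l y * a $ l) + A' v - B' (axis m 1) / 2 = 0"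
proof -
  have lin: "linear (g' k l)" for k l by (rule has_derivative_linear[OF dg])
  have pd: "partial_deriv k (g l n) y = g' l n (axis k 1)" for k l n by (rule partial_deriv_eq[OF dg])
  have "g' k l = g' l k" for k l
    using dg[of k l] dg[of l k] sym[of k l] by (metis has_derivative_unique)
  note g'sym = this
  have A': "A' u = (\<Sum>l\<in>UNIV. g' m l u * v $ l)" for u
  proof -
    have "((\<lambda>z. \<Sum>l\<in>UNIV. g m l z * v $ l) has_derivative (\<lambda>u. \<Sum>l\<in>UNIV. g' m l u * v $ l)) (at y)"
      by (intro has_derivative_sum has_derivative_mult_left dg)
    from has_derivative_unique[OF A this] show ?thesis by simp
  qed
  have B': "B' u = (\<Sum>k\<in>UNIV. \<Sum>l\<in>UNIV. g' k l u * v $ k * v $ l)" for u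
  proof -
    have "((\<lambda>z. \<Sum>k\<in>UNIV. \<Sum>l\<in>UNIV. g k l z * v $ k * v $ l) has_derivative
       (\<lambda>u. \<Sum>k\<in>UNIV. \<Sum>l\<in>UNIV. g' k l u * v $ k * v $ l)) (at y)"
      by (intro has_derivative_sum has_derivative_mult_left dg)
    from has_derivative_unique[OF B this] show ?thesis by simp
  qed
  have 1: "(\<Sum>l\<in>-{i}. g m l y * a $ l) = (\<Sum>l\<in>UNIV. g m l y * a $ l)"
    by (rule sum.mono_neutral_left) (use ai in auto)
  define C where "C k l = christoffel1 g k l m y * v $ k * v $ l" for k l
  have inner: "(\<Sum>l\<in>-{i}. C k l) = (\<Sum>l\<in>UNIV. C k l)" for k
    by (rule sum.mono_neutral_left) (use vi in \<open>auto simp: C_def\<close>)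
  have 2: "(\<Sum>k\<in>-{i}. \<Sum>l\<in>-{i}. C k l) = (\<Sum>k\<in>UNIV. \<Sum>l\<in>UNIV. C k l)"
    unfolding inner by (rule sum.mono_neutral_left) (use vi in \<open>auto simp: C_def\<close>)
  define P where "P k l = g' l m (axis k 1) * v $ k * v $ l" for k l
  have C: "C k l = P k l / 2 + P l k / 2 - g' k l (axis m 1) * v $ k * v $ l / 2" for k l
    by (simp add: C_def P_def christoffel1_def pd algebra_simps add_divide_distrib diff_divide_distrib)
  have swap: "(\<Sum>k\<in>UNIV. \<Sum>l\<in>UNIV. P l k / 2) = (\<Sum>k\<in>UNIV. \<Sum>l\<in>UNIV. P k l / 2)"
    by (rule sum.swap)
  have "(\<Sum>k\<in>UNIV. \<Sum>l\<in>UNIV. P k l) = (\<Sum>l\<in>UNIV. (\<Sum>k\<in>UNIV. v $ k * g' l m (axis k 1)) * v $ l)"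
    unfolding P_def by (subst sum.swap) (simp add: sum_distrib_right sum_distrib_left mult_ac)
  also have "\<dots> = A' v"
    unfolding linear_axis_sum[OF lin] A' by (simp add: g'sym[of m])
  finally have P: "(\<Sum>k\<in>UNIV. \<Sum>l\<in>UNIV. P k l) = A' v" .
  have "(\<Sum>k\<in>UNIV. \<Sum>l\<in>UNIV. C k l) = A' v - B' (axis m 1) / 2"
    unfolding C sum.distrib sum_subtractf swap B' by (simp add: sum_divide_distrib[symmetric] P)
  moreover have "(\<Sum>l\<in>-{i}. g m l y * a $ l) + (\<Sum>k\<in>-{i}. \<Sum>l\<in>-{i}. C k l) = 0"
    using geo m unfolding geodesic_equation_def C_def by blast
  ultimately show ?thesis unfolding 1 2 by linarith
qed

text \<open>The algebraic core of the convexity. With \<open>r = y \<bullet> y\<close>, \<open>b = y \<bullet> x\<close>, \<open>c = v \<bullet> x\<close>, \<open>e = y \<bullet> v\<close>, \<open>s = v \<bullet> v\<close>,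
  \<open>A1 = a \<bullet> x\<close> and \<open>A2 = y \<bullet> a\<close>, the hypothesis is the geodesic equation tested against \<open>x\<close> and the
  left-hand side of the conclusion is the second derivative of \<open>ln r - ln (r - b\<^sup>2)\<close> along the curve.
  The two sides of the conclusion differ by a multiple of the left-hand side of the hypothesis.\<close>
lemma projective_geodesic_identity:
  fixes r b c e s A1 A2 :: real
  defines "Q \<equiv> r - b\<^sup>2" and "p \<equiv> r * c - b * e"
  assumes r: "r > 0" and Q: "r - b\<^sup>2 > 0"
    and eq: "r * (r * A1 - b * A2) + 2 * b * p\<^sup>2 / Q - 2 * r * e * c - b * r * s + 3 * b * e\<^sup>2 = 0"
  shows "2 * (s + A2) / r - 4 * e\<^sup>2 / r\<^sup>2 - (2 * (s + A2) - 2 * c\<^sup>2 - 2 * b * A1) / Q + (2 * e - 2 * b * c)\<^sup>2 / Q\<^sup>2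
    = 2 * p\<^sup>2 / (r\<^sup>2 * Q)"
proof -
  have Q': "Q \<noteq> 0" "r \<noteq> 0" using r Q by (auto simp: Q_def)
  define E where "E = r * (r * A1 - b * A2) * Q + 2 * b * p\<^sup>2 + (- 2 * r * e * c - b * r * s + 3 * b * e\<^sup>2) * Q"
  have "E = (r * (r * A1 - b * A2) + 2 * b * p\<^sup>2 / Q - 2 * r * e * c - b * r * s + 3 * b * e\<^sup>2) * Q"
    using Q' by (simp add: E_def field_simps)
  then have E: "E = 0" using eq by simp
  have "(2 * (s + A2) / r - 4 * e\<^sup>2 / r\<^sup>2 - (2 * (s + A2) - 2 * c\<^sup>2 - 2 * b * A1) / Q + (2 * e - 2 * b * c)\<^sup>2 / Q\<^sup>2)
       * (r\<^sup>2 * Q\<^sup>2) =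
     2 * (s + A2) * r * Q\<^sup>2 - 4 * e\<^sup>2 * Q\<^sup>2 - (2 * (s + A2) - 2 * c\<^sup>2 - 2 * b * A1) * Q * r\<^sup>2 + (2 * e - 2 * b * c)\<^sup>2 * r\<^sup>2"
    using Q' by (simp add: field_simps power2_eq_square)
  also have "\<dots> = 2 * p\<^sup>2 * Q + 2 * b * E"
    unfolding E_def p_def Q_def by algebra
  finally have "(2 * (s + A2) / r - 4 * e\<^sup>2 / r\<^sup>2 - (2 * (s + A2) - 2 * c\<^sup>2 - 2 * b * A1) / Q + (2 * e - 2 * b * c)\<^sup>2 / Q\<^sup>2)
       * (r\<^sup>2 * Q\<^sup>2) = (2 * p\<^sup>2 / (r\<^sup>2 * Q)) * (r\<^sup>2 * Q\<^sup>2)"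
    using E Q' by (simp add: power2_eq_square)
  moreover have W: "r\<^sup>2 * Q\<^sup>2 \<noteq> 0" using Q' by simp
  ultimately show ?thesis by (simp only: mult_right_cancel[OF W])
qed

text \<open>The geodesic equation gives only the components \<open>m \<noteq> i\<close> of this vector equation. The remaining one
  follows since the vector is orthogonal to \<open>y\<close>, whose \<open>i\<close>-th component is \<open>1\<close>: this is the invariance
  of the metric under scaling of \<open>y\<close>, and it uses that \<open>\<alpha>\<close> is constant along rays (\<open>w \<bullet> y = 0\<close>). The
  advantage is that the equation can be tested against an arbitrary vector. Here \<open>w'\<close> is the gradient of
  \<open>\<alpha> / \<parallel>y\<parallel>\<^sup>4\<close>, the conformal factor relative to the form \<open>\<parallel>y\<parallel>\<^sup>2 (h \<bullet> k) - (y \<bullet> h) (y \<bullet> k)\<close>.\<close>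
lemma kappa_geodesic_vector_equation:
  fixes \<alpha> :: "'n::finite proj \<Rightarrow> real" and y v a w :: "real ^ 'n"
  assumes geo: "geodesic_equation (kappa_metric \<alpha>) (- {i}) y v a"
    and yi: "y $ i = 1" and vi: "v $ i = 0" and ai: "a $ i = 0"
    and d\<alpha>: "((\<lambda>z. \<alpha> (Line z)) has_derivative (\<lambda>h. w \<bullet> h)) (at y)" and wy: "w \<bullet> y = 0"
  defines "r \<equiv> y \<bullet> y" and "e \<equiv> y \<bullet> v" and "s \<equiv> v \<bullet> v"
  defines "q0 \<equiv> \<alpha> (Line y) / r\<^sup>2" and "w' \<equiv> w /\<^sub>R r\<^sup>2 - (4 * \<alpha> (Line y) / r ^ 3) *\<^sub>R y"
  shows "q0 *\<^sub>R (r *\<^sub>R a - (y \<bullet> a) *\<^sub>R y) + (w' \<bullet> v) *\<^sub>R (r *\<^sub>R v - e *\<^sub>R y)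
    + q0 *\<^sub>R (2 * e) *\<^sub>R v - q0 *\<^sub>R (2 * s) *\<^sub>R y - ((r * s - e\<^sup>2) / 2) *\<^sub>R w' = 0" (is "?l = 0")
proof -
  have y0: "y \<noteq> 0" using yi by auto
  then have r: "r > 0" by (simp add: r_def)
  define q where "q z = \<alpha> (Line z) * inverse ((z \<bullet> z)\<^sup>2)" for z
  have q0: "q y = q0" by (simp add: q_def q0_def r_def divide_inverse)
  have dr: "((\<lambda>z. z \<bullet> z) has_derivative (\<lambda>h. 2 * (y \<bullet> h))) (at y)"
    by (auto intro!: derivative_eq_intros simp: inner_commute)
  have dq: "(q has_derivative (\<lambda>h. w' \<bullet> h)) (at y)"
  proof -
    have "((\<lambda>x. inverse (x\<^sup>2)) has_real_derivative - 2 * inverse (r ^ 3)) (at r)"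
      using r by (auto intro!: derivative_eq_intros simp: power2_eq_square power3_eq_cube)
    from has_derivative_compose[OF dr this[unfolded has_field_derivative_def r_def]]
    have "((\<lambda>z. inverse ((z \<bullet> z)\<^sup>2)) has_derivative (\<lambda>h. - 2 * inverse (r ^ 3) * (2 * (y \<bullet> h)))) (at y)"
      by (simp add: r_def)
    from has_derivative_mult[OF d\<alpha> this]
    show ?thesis unfolding q_def
      by (rule has_derivative_eq_rhs)
        (auto simp: w'_def r_def[symmetric] inner_diff_left divide_inverse algebra_simps)
  qed
  have dq2: "((\<lambda>z. q z * f z) has_derivative (\<lambda>h. q y * f' h + (w' \<bullet> h) * f y)) (at y)"
    if "(f has_derivative f') (at y)" for f f' by (rule has_derivative_mult[OF dq that])
  have transfer: "(f has_derivative f') (at y)"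
    if "(g has_derivative f') (at y)" "\<And>z. z \<noteq> 0 \<Longrightarrow> g z = f z" for f g :: "real^'n \<Rightarrow> real" and f'
    by (rule has_derivative_transform_within_open[OF that(1), of "-{0}"]) (use y0 that(2) in auto)
  have kappa: "kappa_metric \<alpha> k l z = q z * ((if k = l then z \<bullet> z else 0) - z $ k * z $ l)"
    if "z \<noteq> 0" for k l and z :: "real ^ 'n"
  proof -
    have "norm z ^ 4 = (z \<bullet> z)\<^sup>2" by (simp add: power2_norm_eq_inner[symmetric])
    then show ?thesis
      by (simp add: kappa_metric_def proj_metric_eq[OF that] q_def divide_inverse power2_norm_eq_inner)
  qed
  have sum1: "(\<Sum>l\<in>UNIV. kappa_metric \<alpha> m l z * u $ l) = q z * ((z \<bullet> z) * u $ m - z $ m * (z \<bullet> u))"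
    if "z \<noteq> 0" for m and z u :: "real ^ 'n"
  proof -
    have "(\<Sum>l\<in>UNIV. kappa_metric \<alpha> m l z * u $ l) =
      q z * ((\<Sum>l\<in>UNIV. (if m = l then z \<bullet> z else 0) * u $ l) - (\<Sum>l\<in>UNIV. z $ m * (z $ l * u $ l)))"
      unfolding kappa[OF that] sum_subtractf[symmetric] sum_distrib_left
      by (intro sum.cong refl) (simp add: algebra_simps)
    also have "(\<Sum>l\<in>UNIV. (if m = l then z \<bullet> z else 0) * u $ l) = (\<Sum>l\<in>UNIV. if m = l then (z \<bullet> z) * u $ l else 0)"
      by (intro sum.cong refl) auto
    also have "\<dots> = (z \<bullet> z) * u $ m" by simp
    also have "(\<Sum>l\<in>UNIV. z $ m * (z $ l * u $ l)) = z $ m * (z \<bullet> u)"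
      by (simp add: inner_vec_def sum_distrib_left)
    finally show ?thesis .
  qed
  have sum2: "(\<Sum>k\<in>UNIV. \<Sum>l\<in>UNIV. kappa_metric \<alpha> k l z * v $ k * v $ l) = q z * ((z \<bullet> z) * s - (z \<bullet> v)\<^sup>2)"
    if "z \<noteq> 0" for z
  proof -
    have "(\<Sum>k\<in>UNIV. \<Sum>l\<in>UNIV. kappa_metric \<alpha> k l z * v $ k * v $ l) =
      (\<Sum>k\<in>UNIV. v $ k * (\<Sum>l\<in>UNIV. kappa_metric \<alpha> k l z * v $ l))"
      by (simp add: sum_distrib_left mult_ac)
    also have "\<dots> = q z * ((z \<bullet> z) * (\<Sum>k\<in>UNIV. v $ k * v $ k) - (\<Sum>k\<in>UNIV. z $ k * v $ k) * (z \<bullet> v))"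
      unfolding sum1[OF that] sum_distrib_left sum_distrib_right sum_subtractf[symmetric]
      by (intro sum.cong refl) (simp add: algebra_simps)
    also have "\<dots> = q z * ((z \<bullet> z) * s - (z \<bullet> v)\<^sup>2)"
      by (simp add: s_def inner_vec_def power2_eq_square)
    finally show ?thesis .
  qed
  have comp: "?l $ m = 0" if m: "m \<noteq> i" for m
  proof -
    define A' where "A' h = q y * (2 * (y \<bullet> h) * v $ m - (h $ m * e + y $ m * (h \<bullet> v))) +
        (w' \<bullet> h) * (r * v $ m - y $ m * e)" for h
    define B' where "B' h = q y * (2 * (y \<bullet> h) * s - 2 * e * (h \<bullet> v)) + (w' \<bullet> h) * (r * s - e\<^sup>2)" for h
    have "(\<Sum>l\<in>UNIV. kappa_metric \<alpha> m l y * a $ l) + A' v - B' (axis m 1) / 2 = 0"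
    proof (rule geodesic_equation_contracted[OF geo vi ai _ _ _ _ m])
      show "kappa_metric \<alpha> k l = kappa_metric \<alpha> l k" for k l
        by (simp add: fun_eq_iff kappa_metric_def proj_metric_def inner_commute)
      show "(kappa_metric \<alpha> k l has_derivative
          (\<lambda>h. q y * ((if k = l then 2 * (y \<bullet> h) else 0) - (h $ k * y $ l + y $ k * h $ l)) +
            (w' \<bullet> h) * ((if k = l then y \<bullet> y else 0) - y $ k * y $ l))) (at y)" for k l
      proof (rule transfer)
        have "((\<lambda>z. (if k = l then z \<bullet> z else 0) - z $ k * z $ l) has_derivative
            (\<lambda>h. (if k = l then 2 * (y \<bullet> h) else 0) - (h $ k * y $ l + y $ k * h $ l))) (at y)"
          by (cases "k = l") (auto intro!: derivative_eq_intros dr bounded_linear.has_derivative[OF bounded_linear_vec_nth] simp: fun_eq_iff inner_commute)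
        from dq2[OF this] show "((\<lambda>z. q z * ((if k = l then z \<bullet> z else 0) - z $ k * z $ l)) has_derivative
          (\<lambda>h. q y * ((if k = l then 2 * (y \<bullet> h) else 0) - (h $ k * y $ l + y $ k * h $ l)) +
            (w' \<bullet> h) * ((if k = l then y \<bullet> y else 0) - y $ k * y $ l))) (at y)" .
      qed (simp add: kappa)
      show "((\<lambda>z. \<Sum>l\<in>UNIV. kappa_metric \<alpha> m l z * v $ l) has_derivative A') (at y)"
      proof (rule transfer)
        have "((\<lambda>z. (z \<bullet> z) * v $ m - z $ m * (z \<bullet> v)) has_derivative
          (\<lambda>h. 2 * (y \<bullet> h) * v $ m - (h $ m * e + y $ m * (h \<bullet> v)))) (at y)"
          by (auto intro!: derivative_eq_intros dr bounded_linear.has_derivative[OF bounded_linear_vec_nth]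
            simp: e_def fun_eq_iff inner_commute algebra_simps)
        from dq2[OF this] show "((\<lambda>z. q z * ((z \<bullet> z) * v $ m - z $ m * (z \<bullet> v))) has_derivative A') (at y)"
          by (simp add: A'_def[abs_def] e_def r_def)
      qed (simp add: sum1)
      show "((\<lambda>z. \<Sum>k\<in>UNIV. \<Sum>l\<in>UNIV. kappa_metric \<alpha> k l z * v $ k * v $ l) has_derivative B') (at y)"
      proof (rule transfer)
        have "((\<lambda>z. (z \<bullet> z) * s - (z \<bullet> v)\<^sup>2) has_derivative
          (\<lambda>h. 2 * (y \<bullet> h) * s - 2 * e * (h \<bullet> v))) (at y)"
          by (auto intro!: derivative_eq_intros dr simp: e_def fun_eq_iff inner_commute)
        from dq2[OF this] show "((\<lambda>z. q z * ((z \<bullet> z) * s - (z \<bullet> v)\<^sup>2)) has_derivative B') (at y)"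
          by (simp add: B'_def[abs_def] e_def r_def)
      qed (simp add: sum2)
    qed
    moreover have "(\<Sum>l\<in>UNIV. kappa_metric \<alpha> m l y * a $ l) = q0 * (r * a $ m - y $ m * (y \<bullet> a))"
      using sum1[OF y0] by (simp add: q0 r_def)
    moreover have "A' v = q0 * (e * v $ m - s * y $ m) + (w' \<bullet> v) * (r * v $ m - y $ m * e)"
      by (simp add: A'_def q0 e_def s_def algebra_simps)
    moreover have "B' (axis m 1) = q0 * (2 * s * y $ m - 2 * e * v $ m) + w' $ m * (r * s - e\<^sup>2)"
      by (simp add: B'_def q0 inner_axis inner_axis' algebra_simps)
    ultimately show ?thesis by (simp add: field_simps)
  qed
  have "w' \<bullet> y = - 4 * q0"
    using wy r by (simp add: w'_def inner_diff_left r_def[symmetric] q0_def power2_eq_square power3_eq_cube)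
  then have ly: "?l \<bullet> y = 0"
    by (simp add: inner_add_left inner_diff_left inner_commute[of v y] inner_commute[of a y]
        r_def[symmetric] e_def[symmetric] field_simps power2_eq_square)
  have "?l \<bullet> y = (\<Sum>k\<in>UNIV. ?l $ k * y $ k)" by (simp add: inner_vec_def)
  also have "\<dots> = (\<Sum>k\<in>UNIV. if k = i then ?l $ k * y $ k else 0)"
    by (intro sum.cong refl) (use comp in auto)
  also have "\<dots> = ?l $ i" using yi by simp
  finally have "?l $ i = 0" using ly by simp
  then show ?thesis using comp by (simp only: vec_eq_iff) (metis zero_index)
qed

text \<open>A differentiable function has the same gradient as any differentiable function that touches it from
  below; here the touching function is the inverse squared distance to the line of \<open>x0\<close>.\<close>
lemma touching_gradient:
  fixes y x0 :: "real ^ 'n::finite"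
  assumes d: "\<beta> differentiable (at y)"
    and C: "open C" "y \<in> C" and Q: "\<And>z. z \<in> C \<Longrightarrow> 0 < z \<bullet> z - (z \<bullet> x0)\<^sup>2"
    and below: "\<And>z. z \<in> C \<Longrightarrow> (z \<bullet> z) / (z \<bullet> z - (z \<bullet> x0)\<^sup>2) \<le> \<beta> z"
    and touch: "\<beta> y = (y \<bullet> y) / (y \<bullet> y - (y \<bullet> x0)\<^sup>2)"
  shows "(\<beta> has_derivative (\<lambda>h. ((2 * (y \<bullet> x0) / (y \<bullet> y - (y \<bullet> x0)\<^sup>2)\<^sup>2) *\<^sub>R ((y \<bullet> y) *\<^sub>R x0 - (y \<bullet> x0) *\<^sub>R y)) \<bullet> h)) (at y)"
    (is "(_ has_derivative ?t') _")
proof -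
  define b where "b = y \<bullet> x0"
  define r where "r = y \<bullet> y"
  define q where "q = r - b\<^sup>2"
  have q: "q > 0" using Q[OF C(2)] by (simp add: q_def r_def b_def)
  have dn: "((\<lambda>z. z \<bullet> z) has_derivative (\<lambda>h. 2 * (y \<bullet> h))) (at y)"
    by (auto intro!: derivative_eq_intros simp: inner_commute)
  have dq: "((\<lambda>z. z \<bullet> z - (z \<bullet> x0)\<^sup>2) has_derivative (\<lambda>h. 2 * (y \<bullet> h) - 2 * b * (h \<bullet> x0))) (at y)"
    by (auto intro!: derivative_eq_intros dn simp: b_def fun_eq_iff inner_commute)
  have "((\<lambda>z. (z \<bullet> z) / (z \<bullet> z - (z \<bullet> x0)\<^sup>2)) has_derivative
     (\<lambda>h. (2 * (y \<bullet> h) * q - r * (2 * (y \<bullet> h) - 2 * b * (h \<bullet> x0))) / (q * q))) (at y)"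
    using has_derivative_divide'[OF dn dq] q by (simp add: q_def r_def b_def)
  moreover have "(\<lambda>h. (2 * (y \<bullet> h) * q - r * (2 * (y \<bullet> h) - 2 * b * (h \<bullet> x0))) / (q * q)) = ?t'"
  proof
    fix h
    have "2 * (y \<bullet> h) * q - r * (2 * (y \<bullet> h) - 2 * b * (h \<bullet> x0)) = 2 * b * (r * (x0 \<bullet> h) - b * (y \<bullet> h))"
      by (simp add: q_def algebra_simps power2_eq_square inner_commute)
    then show "(2 * (y \<bullet> h) * q - r * (2 * (y \<bullet> h) - 2 * b * (h \<bullet> x0))) / (q * q) = ?t' h"
      unfolding b_def[symmetric] r_def[symmetric] q_def[symmetric]
      by (simp add: inner_diff_left power2_eq_square)
  qed
  ultimately have dt: "((\<lambda>z. (z \<bullet> z) / (z \<bullet> z - (z \<bullet> x0)\<^sup>2)) has_derivative ?t') (at y)" by simp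
  obtain \<beta>' where \<beta>': "(\<beta> has_derivative \<beta>') (at y)" using d unfolding differentiable_def by blast
  have "(\<lambda>h. \<beta>' h - ?t' h) = (\<lambda>h. 0)"
    by (rule differential_zero_maxmin[OF C(2,1) has_derivative_diff[OF \<beta>' dt]])
      (use below touch in auto)
  then have "\<beta>' = ?t'" by (auto simp: fun_eq_iff)
  then show ?thesis using \<beta>' by simp
qed

text \<open>The gradient of the touching function is, in the projective metric, a multiple of
  the tangential part of \<open>x0\<close>. So
  testing the geodesic equation against \<open>x0\<close> is what eliminates the acceleration.\<close>
lemma touching_second_derivative:
  fixes y v a x0 :: "real ^ 'n::finite"
  assumes geo: "geodesic_equation (kappa_metric \<alpha>) (- {i}) y v a"
    and yi: "y $ i = 1" and vi: "v $ i = 0" and ai: "a $ i = 0" and x0: "norm x0 = 1"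
    and Q: "0 < y \<bullet> y - (y \<bullet> x0)\<^sup>2"
    and \<alpha>: "\<alpha> (Line y) = (y \<bullet> y) / (y \<bullet> y - (y \<bullet> x0)\<^sup>2)"
    and d\<alpha>: "((\<lambda>z. \<alpha> (Line z)) has_derivative
      (\<lambda>h. ((2 * (y \<bullet> x0) / (y \<bullet> y - (y \<bullet> x0)\<^sup>2)\<^sup>2) *\<^sub>R ((y \<bullet> y) *\<^sub>R x0 - (y \<bullet> x0) *\<^sub>R y)) \<bullet> h)) (at y)"
  shows "0 \<le> 2 * (v \<bullet> v + y \<bullet> a) / (y \<bullet> y) - 4 * (y \<bullet> v)\<^sup>2 / (y \<bullet> y)\<^sup>2
    - (2 * (v \<bullet> v + y \<bullet> a) - 2 * (v \<bullet> x0)\<^sup>2 - 2 * (y \<bullet> x0) * (a \<bullet> x0)) / (y \<bullet> y - (y \<bullet> x0)\<^sup>2)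
    + (2 * (y \<bullet> v) - 2 * (y \<bullet> x0) * (v \<bullet> x0))\<^sup>2 / (y \<bullet> y - (y \<bullet> x0)\<^sup>2)\<^sup>2"
proof -
  define r where "r = y \<bullet> y"
  define b where "b = y \<bullet> x0"
  define c where "c = v \<bullet> x0"
  define e where "e = y \<bullet> v"
  define s where "s = v \<bullet> v"
  define A1 where "A1 = a \<bullet> x0"
  define A2 where "A2 = y \<bullet> a"
  define q where "q = r - b\<^sup>2"
  define p where "p = r * c - b * e"
  define w where "w = (2 * b / q\<^sup>2) *\<^sub>R (r *\<^sub>R x0 - b *\<^sub>R y)"
  have xx: "x0 \<bullet> x0 = 1" using x0 by (simp add: norm_eq_1)
  have q: "q > 0" using Q by (simp add: q_def r_def b_def)
  have "y \<noteq> 0" using yi by auto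
  then have r: "r > 0" by (simp add: r_def)
  have \<alpha>y: "\<alpha> (Line y) = r / q" using \<alpha> by (simp add: q_def r_def b_def)
  define w' where "w' = w /\<^sub>R r\<^sup>2 - (4 * \<alpha> (Line y) / r ^ 3) *\<^sub>R y"
  define q0 where "q0 = \<alpha> (Line y) / r\<^sup>2"
  have q0: "q0 = 1 / (r * q)" using r by (simp add: q0_def \<alpha>y power2_eq_square)
  have wy: "w \<bullet> y = 0"
    by (simp add: w_def inner_diff_left inner_commute[of x0] r_def[symmetric] b_def[symmetric])
  have eq: "q0 *\<^sub>R (r *\<^sub>R a - (y \<bullet> a) *\<^sub>R y) + (w' \<bullet> v) *\<^sub>R (r *\<^sub>R v - e *\<^sub>R y)
    + q0 *\<^sub>R (2 * e) *\<^sub>R v - q0 *\<^sub>R (2 * s) *\<^sub>R y - ((r * s - e\<^sup>2) / 2) *\<^sub>R w' = 0"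
    unfolding w'_def q0_def r_def e_def s_def
    by (rule kappa_geodesic_vector_equation[OF geo yi vi ai _ wy])
      (use d\<alpha> in \<open>simp add: w_def q_def r_def b_def\<close>)
  have wv: "w' \<bullet> v = 2 * b * p / (q\<^sup>2 * r\<^sup>2) - 4 * e / (q * r\<^sup>2)"
    using r by (simp add: w'_def w_def \<alpha>y inner_diff_left inner_commute[of x0] p_def
        b_def[symmetric] e_def[symmetric] c_def[symmetric] power2_eq_square power3_eq_cube divide_inverse mult_ac)
  have wx: "w' \<bullet> x0 = - 2 * b / (q * r\<^sup>2)"
  proof -
    have "w' \<bullet> x0 = 2 * b * (r - b * b) / (q\<^sup>2 * r\<^sup>2) - 4 * b / (q * r\<^sup>2)"
      using r by (simp add: w'_def w_def \<alpha>y inner_diff_left xx b_def[symmetric]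
          power2_eq_square power3_eq_cube divide_inverse mult_ac)
    also have "r - b * b = q" by (simp add: q_def power2_eq_square)
    also have "2 * b * q / (q\<^sup>2 * r\<^sup>2) = 2 * b / (q * r\<^sup>2)" using q by (simp add: power2_eq_square)
    finally show ?thesis by simp
  qed
  have "q0 * (r * A1 - A2 * b) + (w' \<bullet> v) * p + q0 * (2 * e * c) - q0 * (2 * s * b)
      - (r * s - e\<^sup>2) / 2 * (w' \<bullet> x0) = 0"
    using arg_cong[OF eq, of "\<lambda>u. u \<bullet> x0"]
    by (simp add: inner_add_left inner_diff_left b_def[symmetric] c_def[symmetric] A1_def[symmetric]
        A2_def[symmetric] p_def mult.commute[of e b])
  then have "(q0 * (r * A1 - A2 * b) + (w' \<bullet> v) * p + q0 * (2 * e * c) - q0 * (2 * s * b)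
      - (r * s - e\<^sup>2) / 2 * (w' \<bullet> x0)) * (q * r\<^sup>2) = 0" by simp
  moreover have "(q0 * (r * A1 - A2 * b) + (w' \<bullet> v) * p + q0 * (2 * e * c) - q0 * (2 * s * b)
      - (r * s - e\<^sup>2) / 2 * (w' \<bullet> x0)) * (q * r\<^sup>2) =
     r * (r * A1 - A2 * b) + (2 * b * p / q - 4 * e) * p + r * (2 * e * c) - r * (2 * s * b) + (r * s - e\<^sup>2) * b"
    unfolding q0 wv wx using r q by (simp add: field_simps power2_eq_square)
  ultimately have "r * (r * A1 - b * A2) + 2 * b * p\<^sup>2 / q - 2 * r * e * c - b * r * s + 3 * b * e\<^sup>2 = 0"
    by (simp add: p_def power2_eq_square algebra_simps)
  from projective_geodesic_identity[OF r q[unfolded q_def] this[unfolded p_def q_def]]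
  have "2 * (s + A2) / r - 4 * e\<^sup>2 / r\<^sup>2 - (2 * (s + A2) - 2 * c\<^sup>2 - 2 * b * A1) / q + (2 * e - 2 * b * c)\<^sup>2 / q\<^sup>2
    = 2 * p\<^sup>2 / (r\<^sup>2 * q)"
    by (simp add: p_def q_def)
  also have "\<dots> \<ge> 0" using r q by simp
  finally show ?thesis
    unfolding r_def b_def c_def e_def s_def A1_def A2_def q_def by simp
qed

section \<open>Convexity along geodesics\<close>

lemma Line_in_chart_domain: "y \<noteq> 0 \<Longrightarrow> Line y \<in> chart_domain i \<longleftrightarrow> y $ i \<noteq> 0"
  using coords_Line(1)[of y i] unfolding chart_domain_def
  by (auto simp: points_of_Line span_singleton)

lemma open_chart_domain:
  fixes i :: "'n::finite"
  shows "open (chart_domain i)"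
proof -
  have "cone_over (chart_domain i) = {y. y $ i \<noteq> 0}"
    using coords_Line(1) by (auto simp: cone_over_def Line_in_chart_domain)
  moreover have "open {y :: real ^ 'n. y $ i \<noteq> 0}" by (intro open_Collect_neq continuous_intros)
  ultimately show ?thesis by (simp add: open_cone_over)
qed

lemma ex_chart: "\<exists>i. L \<in> chart_domain i"
proof -
  obtain x where x: "norm x = 1" "L = Line x" by (rule Line_surj)
  then have "x \<noteq> 0" by auto
  then obtain i where "x $ i \<noteq> 0" by (auto simp: vec_eq_iff)
  then show ?thesis using coords_Line(1) x by blast
qed

lemma coords_in_cone: "L \<in> chart_domain i \<Longrightarrow> L \<in> S \<Longrightarrow> coords i L \<in> cone_over S"
  using coords_chart[of L i] by (force simp: cone_over_def)

text \<open>Continuity is checked through the homogeneous coordinates of the charts, where \<open>f\<close> becomes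
  a function on a vector space.\<close>
lemma continuous_on_along_curve:
  assumes \<gamma>: "continuous_on I \<gamma>" "\<gamma> ` I \<subseteq> S"
    and dv: "\<And>i t. t \<in> I \<Longrightarrow> \<gamma> t \<in> chart_domain i \<Longrightarrow> continuous (at t within I) (\<lambda>s. coords i (\<gamma> s))"
    and f: "\<And>z. z \<in> cone_over S \<Longrightarrow> isCont (\<lambda>z. f (Line z)) z"
  shows "continuous_on I (\<lambda>t. f (\<gamma> t))"
  unfolding continuous_on_def
proof
  fix t assume t: "t \<in> I"
  obtain i where i: "\<gamma> t \<in> chart_domain i" using ex_chart by blast
  have "\<forall>\<^sub>F s in at t within I. \<gamma> s \<in> chart_domain i"
    using \<gamma>(1) t by (intro topological_tendstoD[OF _ open_chart_domain i]) (auto simp: continuous_on_def)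
  moreover have "((\<lambda>s. f (Line (coords i (\<gamma> s)))) \<longlongrightarrow> f (Line (coords i (\<gamma> t)))) (at t within I)"
    using dv[OF t i] unfolding continuous_within
    by (rule isCont_tendsto_compose[OF f, rotated]) (use t i \<gamma>(2) coords_in_cone in blast)
  moreover have "f (Line (coords i (\<gamma> s))) = f (\<gamma> s)" if "\<gamma> s \<in> chart_domain i" for s
    using coords_chart(1)[OF that] by simp
  ultimately show "((\<lambda>t. f (\<gamma> t)) \<longlongrightarrow> f (\<gamma> t)) (at t within I)"
    using i by (simp add: Lim_transform_eventually eventually_mono)
qed

text \<open>At an interior time the one-sided derivatives become two-sided ones and the curve stays in one chart
  for a while. There the \<open>i\<close>-th coordinate is constantly \<open>1\<close>, so velocity and acceleration have no
  \<open>i\<close>-th component.\<close>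
lemma geodesic_in_chart:
  assumes geo: "kappa_geodesic S \<alpha> I \<gamma>" and t: "t \<in> interior I"
  obtains i d and y v :: "real \<Rightarrow> real ^ 'n::finite" and a where "d > 0"
    "\<And>s. \<bar>s - t\<bar> < d \<Longrightarrow> Line (y s) = \<gamma> s \<and> y s \<in> cone_over S \<and> y s $ i = 1 \<and> v s $ i = 0"
    "\<And>s. \<bar>s - t\<bar> < d \<Longrightarrow> (y has_vector_derivative v s) (at s)"
    "(v has_vector_derivative a) (at t)" "a $ i = 0"
    "geodesic_equation (kappa_metric \<alpha>) (- {i}) (y t) (v t) a"
proof -
  have \<gamma>: "continuous_on I \<gamma>" "\<gamma> ` I \<subseteq> S" using geo by (auto simp: kappa_geodesic_def)
  have tI: "t \<in> I" using t interior_subset by blast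
  obtain i where i: "\<gamma> t \<in> chart_domain i" using ex_chart by blast
  obtain v a where va: "\<And>s. s \<in> I \<Longrightarrow> \<gamma> s \<in> chart_domain i \<Longrightarrow>
        ((\<lambda>s. coords i (\<gamma> s)) has_vector_derivative v s) (at s within I) \<and>
        (v has_vector_derivative a s) (at s within I) \<and>
        geodesic_equation (kappa_metric \<alpha>) (- {i}) (coords i (\<gamma> s)) (v s) (a s)"
    using geo unfolding kappa_geodesic_def by meson
  have "\<forall>\<^sub>F s in at t within I. \<gamma> s \<in> chart_domain i"
    using \<gamma>(1) tI by (intro topological_tendstoD[OF _ open_chart_domain i]) (auto simp: continuous_on_def)
  then have "\<forall>\<^sub>F s in at t. \<gamma> s \<in> chart_domain i" using at_within_interior[OF t] by simp
  then have "\<forall>\<^sub>F s in nhds t. \<gamma> s \<in> chart_domain i" using i by (simp add: eventually_nhds_conv_at)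
  moreover have "\<forall>\<^sub>F s in nhds t. s \<in> interior I" using t by (intro eventually_nhds_in_open) auto
  ultimately have "\<forall>\<^sub>F s in nhds t. \<gamma> s \<in> chart_domain i \<and> s \<in> interior I" by eventually_elim simp
  then obtain d where d: "d > 0" "\<And>s. \<bar>s - t\<bar> < d \<Longrightarrow> \<gamma> s \<in> chart_domain i \<and> s \<in> interior I"
    unfolding eventually_nhds_metric by (auto simp: dist_real_def)
  define y where "y s = coords i (\<gamma> s)" for s
  have dy: "(y has_vector_derivative v s) (at s)" if "\<bar>s - t\<bar> < d" for s
    using va[of s] d(2)[OF that] at_within_interior[of s I] interior_subset[of I] by (auto simp: y_def[abs_def])
  have dv: "(v has_vector_derivative a t) (at t)"
    using va[OF tI i] at_within_interior[OF t] by simp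
  have yi: "y s $ i = 1" if "\<bar>s - t\<bar> < d" for s
    using coords_chart(2)[of "\<gamma> s" i] d(2)[OF that] by (simp add: y_def)
  have const: "u $ i = 0" if "(f has_vector_derivative u) (at s)" "\<bar>s - t\<bar> < d"
    "\<And>s. \<bar>s - t\<bar> < d \<Longrightarrow> f s $ i = c" for f and u :: "real ^ 'n" and s c
  proof -
    have "((\<lambda>s. f s $ i) has_vector_derivative u $ i) (at s)"
      by (rule bounded_linear.has_vector_derivative[OF bounded_linear_vec_nth that(1)])
    moreover have "((\<lambda>s. f s $ i) has_vector_derivative 0) (at s)"
      by (rule has_vector_derivative_transform_within_open[of "\<lambda>_. c" _ _ "{t-d<..<t+d}"])
        (use that in auto)
    ultimately show ?thesis by (rule vector_derivative_unique_at)
  qed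
  have vi: "v s $ i = 0" if "\<bar>s - t\<bar> < d" for s by (rule const[OF dy[OF that] that yi])
  show ?thesis
  proof (rule that[OF d(1)])
    show "Line (y s) = \<gamma> s \<and> y s \<in> cone_over S \<and> y s $ i = 1 \<and> v s $ i = 0" if "\<bar>s - t\<bar> < d" for s
      using coords_chart[of "\<gamma> s" i] coords_in_cone[of "\<gamma> s" i S] d(2)[OF that] \<gamma>(2) vi[OF that]
        interior_subset[of I] by (auto simp: y_def)
    show "a t $ i = 0" by (rule const[OF dv _ vi]) (use d(1) in auto)
    show "geodesic_equation (kappa_metric \<alpha>) (- {i}) (y t) (v t) (a t)"
      using va[OF tI i] by (simp add: y_def)
  qed (fact dy dv)+
qed

lemma touching_value_derivatives:
  fixes y v :: "real \<Rightarrow> 'a::real_inner"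
  assumes d: "d > 0" and dy: "\<And>s. \<bar>s - t\<bar> < d \<Longrightarrow> (y has_vector_derivative v s) (at s)"
    and dv: "(v has_vector_derivative a) (at t)"
    and Q: "\<And>s. \<bar>s - t\<bar> < d \<Longrightarrow> 0 < y s \<bullet> y s - (y s \<bullet> x)\<^sup>2"
  defines "f \<equiv> \<lambda>s. ln (y s \<bullet> y s) - ln (y s \<bullet> y s - (y s \<bullet> x)\<^sup>2)"
    and "f' \<equiv> \<lambda>s. 2 * (y s \<bullet> v s) / (y s \<bullet> y s)
        - (2 * (y s \<bullet> v s) - 2 * (y s \<bullet> x) * (v s \<bullet> x)) / (y s \<bullet> y s - (y s \<bullet> x)\<^sup>2)"
  shows "\<bar>s - t\<bar> < d \<Longrightarrow> (f has_real_derivative f' s) (at s)"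
    and "(f' has_real_derivative
      2 * (v t \<bullet> v t + y t \<bullet> a) / (y t \<bullet> y t) - 4 * (y t \<bullet> v t)\<^sup>2 / (y t \<bullet> y t)\<^sup>2
      - (2 * (v t \<bullet> v t + y t \<bullet> a) - 2 * (v t \<bullet> x)\<^sup>2 - 2 * (y t \<bullet> x) * (a \<bullet> x)) / (y t \<bullet> y t - (y t \<bullet> x)\<^sup>2)
      + (2 * (y t \<bullet> v t) - 2 * (y t \<bullet> x) * (v t \<bullet> x))\<^sup>2 / (y t \<bullet> y t - (y t \<bullet> x)\<^sup>2)\<^sup>2) (at t)"
proof -
  have inner: "((\<lambda>s. f s \<bullet> g s) has_real_derivative f s \<bullet> g' + g s \<bullet> f') (at s)"
    if "(f has_vector_derivative f') (at s)" "(g has_vector_derivative g') (at s)"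
    for f g :: "real \<Rightarrow> 'a" and f' g' s
    using has_derivative_inner[OF that[unfolded has_vector_derivative_def]]
    by (simp add: has_field_derivative_def inner_commute distrib_left[symmetric] mult_commute_abs)
  have const: "((\<lambda>s. x) has_vector_derivative 0) (at s)" for s by simp
  have pos: "0 < y s \<bullet> y s" if "\<bar>s - t\<bar> < d" for s
    using Q[OF that] zero_le_power2[of "y s \<bullet> x"] by linarith
  have dr: "((\<lambda>s. y s \<bullet> y s) has_real_derivative 2 * (y s \<bullet> v s)) (at s)" if "\<bar>s - t\<bar> < d" for s
    using inner[OF dy[OF that] dy[OF that]] by simp
  have db: "((\<lambda>s. y s \<bullet> x) has_real_derivative v s \<bullet> x) (at s)" if "\<bar>s - t\<bar> < d" for s
    using inner[OF dy[OF that] const] by (simp add: inner_commute)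
  have dQ: "((\<lambda>s. y s \<bullet> y s - (y s \<bullet> x)\<^sup>2) has_real_derivative
     2 * (y s \<bullet> v s) - 2 * (y s \<bullet> x) * (v s \<bullet> x)) (at s)" if "\<bar>s - t\<bar> < d" for s
    using DERIV_diff[OF dr[OF that] DERIV_power[OF db[OF that], of 2]] by (simp add: mult_ac)
  show "(f has_real_derivative f' s) (at s)" if s: "\<bar>s - t\<bar> < d"
    unfolding f_def f'_def
    using DERIV_diff[OF DERIV_chain2[OF DERIV_ln[OF pos[OF s]] dr[OF s]] DERIV_chain2[OF DERIV_ln[OF Q[OF s]] dQ[OF s]]]
    by (simp add: divide_inverse mult_ac)
  have t: "\<bar>t - t\<bar> < d" using d by simp
  have de: "((\<lambda>s. y s \<bullet> v s) has_real_derivative y t \<bullet> a + v t \<bullet> v t) (at t)"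
    by (rule inner[OF dy[OF t] dv])
  have dc: "((\<lambda>s. v s \<bullet> x) has_real_derivative a \<bullet> x) (at t)"
    using inner[OF dv const] by (simp add: inner_commute)
  define r where "r = y t \<bullet> y t"
  define q where "q = y t \<bullet> y t - (y t \<bullet> x)\<^sup>2"
  have nz: "r \<noteq> 0" "q \<noteq> 0" using pos[OF t] Q[OF t] by (auto simp: r_def q_def)
  have 1: "((\<lambda>s. 2 * (y s \<bullet> v s) / (y s \<bullet> y s)) has_real_derivative
      (2 * (y t \<bullet> a + v t \<bullet> v t) * r - 2 * (y t \<bullet> v t) * (2 * (y t \<bullet> v t))) / (r * r)) (at t)"
    unfolding r_def by (rule DERIV_divide[OF DERIV_cmult[OF de] dr[OF t]]) (use nz in \<open>simp add: r_def\<close>)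
  have 2: "((\<lambda>s. 2 * (y s \<bullet> v s) - 2 * (y s \<bullet> x) * (v s \<bullet> x)) has_real_derivative
      2 * (y t \<bullet> a + v t \<bullet> v t) - (2 * (v t \<bullet> x) * (v t \<bullet> x) + (a \<bullet> x) * (2 * (y t \<bullet> x)))) (at t)"
    by (intro DERIV_diff DERIV_cmult de DERIV_mult db dc t)
  have 3: "((\<lambda>s. (2 * (y s \<bullet> v s) - 2 * (y s \<bullet> x) * (v s \<bullet> x)) / (y s \<bullet> y s - (y s \<bullet> x)\<^sup>2)) has_real_derivative
     ((2 * (y t \<bullet> a + v t \<bullet> v t) - (2 * (v t \<bullet> x) * (v t \<bullet> x) + (a \<bullet> x) * (2 * (y t \<bullet> x)))) * q
      - (2 * (y t \<bullet> v t) - 2 * (y t \<bullet> x) * (v t \<bullet> x)) * (2 * (y t \<bullet> v t) - 2 * (y t \<bullet> x) * (v t \<bullet> x))) / (q * q)) (at t)"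
    unfolding q_def by (rule DERIV_divide[OF 2 dQ[OF t]]) (use nz in \<open>simp add: q_def\<close>)
  show "(f' has_real_derivative
      2 * (v t \<bullet> v t + y t \<bullet> a) / (y t \<bullet> y t) - 4 * (y t \<bullet> v t)\<^sup>2 / (y t \<bullet> y t)\<^sup>2
      - (2 * (v t \<bullet> v t + y t \<bullet> a) - 2 * (v t \<bullet> x)\<^sup>2 - 2 * (y t \<bullet> x) * (a \<bullet> x)) / (y t \<bullet> y t - (y t \<bullet> x)\<^sup>2)
      + (2 * (y t \<bullet> v t) - 2 * (y t \<bullet> x) * (v t \<bullet> x))\<^sup>2 / (y t \<bullet> y t - (y t \<bullet> x)\<^sup>2)\<^sup>2) (at t)"
    unfolding f'_def unfolding q_def[symmetric] unfolding r_def[symmetric]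
    by (rule DERIV_cong[OF DERIV_diff[OF 1 3]])
      (use nz in \<open>simp add: diff_divide_distrib add_divide_distrib power2_eq_square add.commute mult_ac\<close>)
qed

lemma convex_on_ln_along_geodesic:
  fixes N :: "'n::finite proj set"
  assumes N: "C2_submanifold d N"
  defines "S \<equiv> unique_closest_domain N - N" and "\<alpha> \<equiv> \<lambda>x. dP_set x N powi (-2)"
  assumes geo: "kappa_geodesic S \<alpha> I \<gamma>"
  shows "convex_on I (\<lambda>t. ln (\<alpha> (\<gamma> t)))"
proof -
  have oS: "open S" and C2: "C2_on_proj \<alpha> S" and pos: "\<And>x. x \<in> S \<Longrightarrow> \<alpha> x > 0"
    unfolding S_def \<alpha>_def using C2_on_dP_set[OF N] by blast+
  have \<gamma>: "is_interval I" "continuous_on I \<gamma>" "\<gamma> ` I \<subseteq> S" using geo by (auto simp: kappa_geodesic_def)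
  have diff: "(\<lambda>z. \<alpha> (Line z)) differentiable (at z)" if "z \<in> cone_over S" for z
    using C2 that unfolding C2_on_proj_def cone_over_def[symmetric] C2_on_def differentiable_def by blast
  let ?D = "cone_over (unique_closest_domain N)"
  have SD: "z \<in> ?D" "0 < z \<bullet> z - (z \<bullet> nearest_lift N z)\<^sup>2" "z \<noteq> 0" if "z \<in> cone_over S" for z
    using that cone_over_complement[of N] by (auto simp: S_def cone_over_def)
  have val: "\<alpha> (Line z) = (z \<bullet> z) / (z \<bullet> z - (z \<bullet> nearest_lift N z)\<^sup>2)" if "z \<in> cone_over S" for z
    unfolding \<alpha>_def
    using dP_set_Line[OF SD(3)[OF that] _ nearest_lift(3)[OF SD(1)[OF that]]] nearest_lift(1)[OF SD(1)[OF that]]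
    by (simp add: unit_lifts_def)
  have le: "0 < z \<bullet> z - (z \<bullet> x)\<^sup>2" "(z \<bullet> z) / (z \<bullet> z - (z \<bullet> x)\<^sup>2) \<le> \<alpha> (Line z)"
    if z: "z \<in> cone_over S" and x: "x \<in> unit_lifts N" for z x
  proof -
    have "\<bar>z \<bullet> x\<bar> \<le> \<bar>z \<bullet> nearest_lift N z\<bar>" using nearest_lift(2)[OF SD(1)[OF z] x] by linarith
    then have sq: "(z \<bullet> x)\<^sup>2 \<le> (z \<bullet> nearest_lift N z)\<^sup>2" by (simp add: abs_le_square_iff)
    then show "0 < z \<bullet> z - (z \<bullet> x)\<^sup>2" using SD(2)[OF z] by linarith
    show "(z \<bullet> z) / (z \<bullet> z - (z \<bullet> x)\<^sup>2) \<le> \<alpha> (Line z)"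
      unfolding val[OF z] using SD(2)[OF z] sq by (intro divide_left_mono mult_pos_pos) auto
  qed
  show ?thesis
  proof (rule convex_on_if_supported[OF \<gamma>(1)])
    show "continuous_on I (\<lambda>t. ln (\<alpha> (\<gamma> t)))"
    proof (rule continuous_on_along_curve[OF \<gamma>(2,3)])
      show "continuous (at t within I) (\<lambda>s. coords i (\<gamma> s))" if "t \<in> I" "\<gamma> t \<in> chart_domain i" for i t
        using geo that unfolding kappa_geodesic_def by (meson has_vector_derivative_continuous)
      show "isCont (\<lambda>z. ln (\<alpha> (Line z))) z" if "z \<in> cone_over S" for z
        using differentiable_imp_continuous_within[OF diff[OF that]] pos[of "Line z"] that
        by (intro continuous_intros) (auto simp: cone_over_def)
    qed
    fix t assume "t \<in> interior I"
    from geo this obtain i d y v a where d: "d > 0"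
      and y: "\<And>s. \<bar>s - t\<bar> < d \<Longrightarrow> Line (y s) = \<gamma> s \<and> y s \<in> cone_over S \<and> y s $ i = 1 \<and> v s $ i = 0"
      and dy: "\<And>s. \<bar>s - t\<bar> < d \<Longrightarrow> (y has_vector_derivative v s) (at s)"
      and dv: "(v has_vector_derivative a) (at t)" and ai: "a $ i = 0"
      and eq: "geodesic_equation (kappa_metric \<alpha>) (- {i}) (y t) (v t) a"
      by (rule geodesic_in_chart) (rule that)
    have yt: "y t \<in> cone_over S" "y t $ i = 1" "v t $ i = 0" "Line (y t) = \<gamma> t" using y[of t] d by auto
    define x where "x = nearest_lift N (y t)"
    have x: "x \<in> unit_lifts N" "norm x = 1"
      using nearest_lift(1)[OF SD(1)[OF yt(1)]] by (auto simp: x_def unit_lifts_def)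
    have touch: "\<alpha> (Line (y t)) = (y t \<bullet> y t) / (y t \<bullet> y t - (y t \<bullet> x)\<^sup>2)"
      unfolding x_def by (rule val[OF yt(1)])
    have Q: "0 < y s \<bullet> y s - (y s \<bullet> x)\<^sup>2" if "\<bar>s - t\<bar> < d" for s using le(1) y[OF that] x(1) by blast
    have oC: "open (cone_over S)" using oS by (simp add: open_cone_over)
    note grad = touching_gradient[OF diff[OF yt(1)] oC yt(1) le[OF _ x(1)] touch]
    note nonneg = touching_second_derivative[OF eq yt(2,3) ai x(2) le(1)[OF yt(1) x(1)] touch grad]
    define f where "f = (\<lambda>s. ln (y s \<bullet> y s) - ln (y s \<bullet> y s - (y s \<bullet> x)\<^sup>2))"
    have f: "f s = ln ((y s \<bullet> y s) / (y s \<bullet> y s - (y s \<bullet> x)\<^sup>2))" if "\<bar>s - t\<bar> < d" for s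
      using Q[OF that] SD(3)[of "y s"] y[OF that] by (simp add: f_def ln_div)
    obtain f' c where deriv: "0 \<le> c" "\<And>s. \<bar>s - t\<bar> < d \<Longrightarrow> (f has_real_derivative f' s) (at s)"
      "(f' has_real_derivative c) (at t)"
      by (rule that[OF nonneg touching_value_derivatives(1)[OF d dy dv Q, folded f_def]
            touching_value_derivatives(2)[OF d dy dv Q]])
    have "f t = ln (\<alpha> (\<gamma> t))" using f[of t] d touch yt(4) by simp
    moreover have "f s \<le> ln (\<alpha> (\<gamma> s))" if s: "\<bar>s - t\<bar> < d" for s
    proof -
      have "0 < (y s \<bullet> y s) / (y s \<bullet> y s - (y s \<bullet> x)\<^sup>2)"
        using Q[OF s] SD(3)[of "y s"] y[OF s] by (intro divide_pos_pos) auto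
      then show ?thesis
        unfolding f[OF s] using le(2)[of "y s" x] y[OF s] x(1) by (intro ln_mono) auto
    qed
    ultimately show "\<exists>f f' c d. d > 0 \<and> 0 \<le> c \<and> f t = ln (\<alpha> (\<gamma> t)) \<and>
      (\<forall>s. \<bar>s - t\<bar> < d \<longrightarrow> f s \<le> ln (\<alpha> (\<gamma> s)) \<and> (f has_real_derivative f' s) (at s)) \<and>
      (f' has_real_derivative c) (at t)"
      using d deriv by blast
  qed
qed

theorem corollary1:
  fixes N :: "'n::finite proj set" and d :: nat
  assumes "C2_submanifold d N"
  shows "self_convex (unique_closest_domain N - N) (\<lambda>x. dP_set x N powi (-2))"
  unfolding self_convex_def
  using C2_on_dP_set[OF assms] convex_on_ln_along_geodesic[OF assms] by blast

end
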